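(* Let $L\in\mathbb{R}^{m\times n}$ be nonzero, $A:\mathbb{R}^n\rightrightarrows\mathbb{R}^n$, $B:\mathbb{R}^m\rightrightarrows\mathbb{R}^m$, and $\gamma,\tau>0$. Assume: (A1) $A$ and $B$ are outer semicontinuous. (A2) $\operatorname{dom}J_{\gamma A}=\mathbb{R}^n$ and $\operatorname{dom}J_{\tau B^{-1}}=\mathbb{R}^m$. (A3) $\operatorname{zer}T_{\rm PD}\neq\emptyset$ and there exist $\beta_P,\beta_P',\beta_D,\beta_D'\in\mathbb{R}$ and a nonempty set $\mathcal S^\star\subseteq\operatorname{zer}T_{\rm PD}$ such that $T_{\rm PD}$ has $V$-oblique weak Minty solutions at $\mathcal S^\star$, where $$V=\bigl(\beta_P\Pi_{\operatorname{range}L^\top}+\beta_P'\Pi_{\ker L}\bigr)\oplus\bigl(\beta_D\Pi_{\operatorname{range}L}+\beta_D'\Pi_{\ker L^\top}\bigr).$$ Moreover, with $\delta:=1-[\beta_P\beta_D]_-(\|L\|^2-\sigma_d^2)$: $[\beta_P]_-[\beta_D]_-<\frac1{4\|L\|^2}$; $\beta_P'\ge0$ if $\beta_P\ge0$ and $\beta_P'\ge\frac{\beta_P}{\delta-\beta_P\beta_D\|L\|^2}$ if $\beta_P<0$; $\beta_D'\ge0$ if $\beta_D\ge0$ and $\beta_D'\ge\frac{\beta_D}{\delta-\beta_P\beta_D\|L\|^2}$ if $\beta_D<0$. (Convention: $\beta_P'$ is set to $+\infty$ when $\operatorname{rank}L=n$, and $\beta_D'$ is set to $+\infty$ when $\operatorname{rank}L=m$,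 since $V$ does not depend on them in these cases.) Assume that $\gamma,\tau$ satisfy the stepsize rule: with $$\gamma_{\min}=\tfrac{-2\beta_P}{\delta+\sqrt{\delta^2-4\beta_P\beta_D\|L\|^2}},\quad \gamma_{\max}=\tfrac{\delta+\sqrt{\delta^2-4\beta_P\beta_D\|L\|^2}}{-2\beta_D\|L\|^2},\quad \tau_{\min}(\gamma)=\tfrac{[-\beta_D(\gamma+\beta_P)]_+}{\gamma(\delta-\beta_P\beta_D\|L\|^2)+\beta_P},$$ - if $\beta_P\ge0,\beta_D\ge0$: $\gamma\in(0,\infty)$, $\tau\in(0,\frac1{\gamma\|L\|^2}]$; - if $\beta_P\ge0,\beta_D<0$: $\gamma\in(0,\gamma_{\max})$, $\tau\in(\tau_{\min}(\gamma),\frac1{\gamma\|L\|^2}]$; - if $\beta_P<0,\beta_D\ge0$: $\gamma\in(\gamma_{\min},\infty)$, $\tau\in(\tau_{\min}(\gamma),\frac1{\gamma\|L\|^2}]$; - if $\beta_P<0,\beta_D<0$: $\gamma\in(\gamma_{\min},\gamma_{\max})$, $\tau\in(\tau_{\min}(\gamma),\frac1{\gamma\|L\|^2}]$. Assume that $(\lambda_k)_{k\in\mathbb N}$ satisfies the relaxation rule: $\lambda_k\in(0,2(1+\bar\eta))$ and $\liminf_{k\to\infty}\lambda_k(2(1+\bar\eta)-\lambda_k)>0$, where $\bar\eta=\min\{\eta,\eta'\}$, $\eta'=\min\{\frac1\gamma\beta_P',\frac1\tau\beta_D'\}$ (with the convention above), and, with $\Delta=\frac1{2\gamma}\beta_P+\frac1{2\tau}\beta_D$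 and $\theta(\sigma)=\sqrt{(\frac1{2\gamma}\beta_P-\frac1{2\tau}\beta_D)^2+\beta_P\beta_D\sigma^2}$, - if $\gamma\tau<\frac1{\|L\|^2}$: $\eta=\Delta-\theta(\sigma_d)$ if $\beta_P\beta_D<0$, and $\eta=\Delta-\theta(\|L\|)$ if $\beta_P\beta_D\ge0$; - if $\gamma\tau=\frac1{\|L\|^2}$ and $d=1$: $\eta=2\Delta$; - if $\gamma\tau=\frac1{\|L\|^2}$ and $d>1$: $\eta=\Delta-\theta(\sigma_d)$ if $\beta_P\beta_D<0$; $\eta=\Delta-\theta(\sigma_2)$ if $\min\{\beta_P,\beta_D\}\ge0$; $\eta=2\Delta$ otherwise. Let $(z^k)=(x^k,y^k)$ and $(\bar z^k)=(\bar x^k,\bar y^k)$ be generated by CPA from $z^0\in\mathbb{R}^{n+m}$. Then either a point $\bar z^k\in\operatorname{zer}T_{\rm PD}$ is reached in a finite number of iterations, or the following hold: (i) $\bar v^k:=P(z^k-\bar z^k)\in T_{\rm PD}\bar z^k$ for all $k$, and $(\bar v^k)$ converges to zero. (ii) Every limit point (if any) of $(\bar z^k)$ belongs to $\operatorname{zer}T_{\rm PD}$. (iii) The sequences $(\Pi_{\operatorname{range}P}z^k)$ and $(\Pi_{\operatorname{range}P}\bar z^k)$ are bounded and their limit points belong to $\Pi_{\operatorname{range}P}\operatorname{zer}T_{\rm PD}$. (iv) If $\Pi_{\operatorname{range}P}\mathcal S^\star=\Pi_{\operatorname{range}P}\operatorname{zer}T_{\rm PD}$, then $(\Pi_{\operatorname{range}P}z^k)$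 and $(\Pi_{\operatorname{range}P}\bar z^k)$ converge to some element of $\Pi_{\operatorname{range}P}\operatorname{zer}T_{\rm PD}$. If additionally $J_{\gamma A}$ and $J_{\tau B^{-1}}$ are (single-valued) continuous, then $(\bar z^k)$ converges to some $z^\star\in\operatorname{zer}T_{\rm PD}$. Finally, if additionally $\lambda_k$ is uniformly bounded in the interval $(0,2)$, then $(z^k)$ also converges to $z^\star$.
   Context: For a set-valued operator $A$: $\operatorname{gph}A=\{(x,y):y\in Ax\}$, $\operatorname{zer}A=\{x:0\in Ax\}$, $A^{-1}$ is the inverse relation, $J_A=(\mathrm{id}+A)^{-1}$. $A$ is outer semicontinuous if its graph is closed. $[t]_+=\max\{0,t\}$, $[t]_-=-\min\{0,t\}$. $\oplus$ denotes block-diagonal direct sum of matrices, $\Pi_E$ the orthogonal projection onto the subspace $E$ (applied elementwise to sets). $\sigma_1>\dots>\sigma_d>0$ are the distinct strictly positive singular values of $L$; $\|L\|=\sigma_1$. $T_{\rm PD}:\mathbb{R}^{n+m}\rightrightarrows\mathbb{R}^{n+m}$, $T_{\rm PD}(x,y)=(Ax+L^\top y)\times(B^{-1}y-Lx)$. For symmetric $V$ (possibly indefinite), an operator $T:\mathbb{R}^N\rightrightarrows\mathbb{R}^N$ has $V$-oblique weak Minty solutions at a nonempty set $\mathcal S^\star\subseteq\operatorname{zer}T$ if $\langle v,z-z^\star\rangle\ge\langle v,Vv\rangle$ for all $z^\star\in\mathcal S^\star$ and $(z,v)\in\operatorname{gph}T$. Chambolle--Pock algorithm (CPA): given $\gamma,\tau>0$,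 $\lambda_k>0$, $z^0=(x^0,y^0)$, iterate $\bar x^k\in J_{\gamma A}(x^k-\gamma L^\top y^k)$, $\bar y^k\in J_{\tau B^{-1}}(y^k+\tau L(2\bar x^k-x^k))$, $x^{k+1}=x^k+\lambda_k(\bar x^k-x^k)$, $y^{k+1}=y^k+\lambda_k(\bar y^k-y^k)$. $P=\begin{bmatrix}\frac1\gamma I_n&-L^\top\\-L&\frac1\tau I_m\end{bmatrix}$. "Uniformly bounded in $(0,2)$" means contained in a compact subinterval of $(0,2)$. *)

theory Defs
  imports "HOL-Analysis.Analysis"
begin

section \<open>Set-valued operators\<close>

definition gph :: "('a \<Rightarrow> 'b set) \<Rightarrow> ('a \<times> 'b) set" where
  "gph A = {(x, y). y \<in> A x}"

definition dom_op :: "('a \<Rightarrow> 'b set) \<Rightarrow> 'a set" where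
  "dom_op A = {x. A x \<noteq> {}}"

definition zer :: "('a \<Rightarrow> 'b::zero set) \<Rightarrow> 'a set" where
  "zer A = {x. 0 \<in> A x}"

definition inv_op :: "('a \<Rightarrow> 'b set) \<Rightarrow> 'b \<Rightarrow> 'a set" where
  "inv_op A y = {x. y \<in> A x}"

definition scale_op :: "real \<Rightarrow> ('a \<Rightarrow> 'b::real_vector set) \<Rightarrow> 'a \<Rightarrow> 'b set" where
  "scale_op c A x = (\<lambda>a. c *\<^sub>R a) ` A x"

definition resolvent :: "('a::real_vector \<Rightarrow> 'a set) \<Rightarrow> 'a \<Rightarrow> 'a set" where
  "resolvent A = inv_op (\<lambda>x. (\<lambda>a. x + a) ` A x)"

definition outer_semicontinuous ::
    "('a::topological_space \<Rightarrow> 'b::topological_space set) \<Rightarrow> bool" where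
  "outer_semicontinuous A \<longleftrightarrow> closed (gph A)"

definition single_valued_continuous ::
    "('a::topological_space \<Rightarrow> 'b::topological_space set) \<Rightarrow> bool" where
  "single_valued_continuous A \<longleftrightarrow>
     (\<exists>f. continuous_on UNIV f \<and> (\<forall>x. A x = {f x}))"

text \<open>The linear map \<open>V\<close> is meant to be symmetric, possibly indefinite; the instance
  \<open>V_mat\<close> below always is.\<close>

definition oblique_weak_Minty ::
    "('a::real_inner \<Rightarrow> 'a) \<Rightarrow> ('a \<Rightarrow> 'a set) \<Rightarrow> 'a set \<Rightarrow> bool" where
  "oblique_weak_Minty V T S \<longleftrightarrow>
     S \<noteq> {} \<and> S \<subseteq> zer T \<and>
     (\<forall>zs\<in>S. \<forall>(z, v)\<in>gph T. v \<bullet> (z - zs) \<ge> v \<bullet> V v)"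


section \<open>Linear algebra\<close>

definition pos_part :: "real \<Rightarrow> real" where "pos_part t = max 0 t"

definition neg_part :: "real \<Rightarrow> real" where "neg_part t = - min 0 t"

definition orth_proj :: "'a::euclidean_space set \<Rightarrow> 'a \<Rightarrow> 'a" where
  "orth_proj E x = (THE p. p \<in> E \<and> x - p \<in> E\<^sup>\<bottom>)"

lemma orth_proj_eqI:
  assumes E: "subspace E" and p: "p \<in> E" "x - p \<in> E\<^sup>\<bottom>"
  shows "orth_proj E x = p"
  unfolding orth_proj_def
proof (rule the_equality)
  fix q assume q: "q \<in> E \<and> x - q \<in> E\<^sup>\<bottom>"
  have "q - p \<in> E" using q p E by (simp add: subspace_diff)
  moreover have "q - p \<in> E\<^sup>\<bottom>"
    using subspace_diff[OF subspace_orthogonal_comp p(2), of "x - q"] q by simp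
  ultimately show "q = p" by (auto simp: orthogonal_comp_def orthogonal_def)
qed (use p in simp)

lemma orth_proj_closest_point:
  fixes E :: "'a::euclidean_space set"
  assumes "subspace E"
  shows "orth_proj E x = closest_point E x"
proof (rule orth_proj_eqI[OF assms])
  have ne: "E \<noteq> {}" using assms subspace_0 by blast
  have cl: "closed E" using assms by (rule closed_subspace)
  show mem: "closest_point E x \<in> E" using cl ne by (rule closest_point_in_set)
  show "x - closest_point E x \<in> E\<^sup>\<bottom>"
    unfolding orthogonal_comp_def
  proof (clarify)
    fix y assume y: "y \<in> E"
    let ?p = "closest_point E x"
    have 1: "?p + y \<in> E" "?p - y \<in> E"
      using mem y assms by (auto simp: subspace_add subspace_diff)
    have "(x - ?p) \<bullet> ((?p + y) - ?p) \<le> 0"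
      using closest_point_dot[OF subspace_imp_convex[OF assms] cl 1(1)] .
    moreover have "(x - ?p) \<bullet> ((?p - y) - ?p) \<le> 0"
      using closest_point_dot[OF subspace_imp_convex[OF assms] cl 1(2)] .
    ultimately show "orthogonal y (x - ?p)"
      by (simp add: orthogonal_def inner_commute)
  qed
qed

text \<open>The instance \<open>norm L\<close> of the library is the Frobenius norm, hence \<open>onorm\<close> here.\<close>

abbreviation opnorm :: "real^'n^'m \<Rightarrow> real" where
  "opnorm L \<equiv> onorm ((*v) L)"

definition ker :: "real^'n^'m \<Rightarrow> (real^'n) set" where
  "ker L = {x. L *v x = 0}"

definition rng :: "real^'n^'m \<Rightarrow> (real^'m) set" where
  "rng L = range ((*v) L)"

definition pos_singular_values :: "real^'n^'m \<Rightarrow> real set" where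
  "pos_singular_values L =
     {\<sigma>. \<sigma> > 0 \<and> (\<exists>v. v \<noteq> 0 \<and> transpose L *v (L *v v) = \<sigma>\<^sup>2 *\<^sub>R v)}"

lemma finite_pos_singular_values: "finite (pos_singular_values (L::real^'n^'m))"
proof -
  let ?S = "pos_singular_values L"
  have "\<forall>\<sigma>\<in>?S. \<exists>v. v \<noteq> 0 \<and> transpose L *v (L *v v) = \<sigma>\<^sup>2 *\<^sub>R v"
    by (simp add: pos_singular_values_def)
  then obtain w where
    "\<forall>\<sigma>\<in>?S. w \<sigma> \<noteq> 0 \<and> transpose L *v (L *v w \<sigma>) = \<sigma>\<^sup>2 *\<^sub>R w \<sigma>"
    using bchoice by meson
  then have w: "w \<sigma> \<noteq> 0" "transpose L *v (L *v w \<sigma>) = \<sigma>\<^sup>2 *\<^sub>R w \<sigma>" if "\<sigma> \<in> ?S" for \<sigma>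
    using that by auto
  have sym: "(transpose L *v (L *v u)) \<bullet> v = u \<bullet> (transpose L *v (L *v v))" for u v
    by (metis dot_lmul_matrix inner_commute vector_transpose_matrix transpose_transpose)
  have orth: "w s \<bullet> w t = 0" if "s \<in> ?S" "t \<in> ?S" "s \<noteq> t" for s t
  proof -
    have "s\<^sup>2 * (w s \<bullet> w t) = t\<^sup>2 * (w s \<bullet> w t)"
      using sym[of "w s" "w t"] w(2) that by simp
    moreover have "s\<^sup>2 \<noteq> t\<^sup>2"
      using that by (auto simp: pos_singular_values_def power2_eq_iff)
    ultimately show ?thesis by simp
  qed
  have "inj_on w ?S"
    using orth w(1) by (metis inj_onI inner_eq_zero_iff)
  moreover have "pairwise orthogonal (w ` ?S)"
    unfolding pairwise_def orthogonal_def using orth by auto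
  ultimately show ?thesis
    using pairwise_orthogonal_imp_finite finite_imageD by blast
qed

definition num_sv :: "real^'n^'m \<Rightarrow> nat" where
  "num_sv L = card (pos_singular_values L)"

text \<open>For \<open>1 \<le> i \<le> num_sv L\<close>, \<open>sv L i\<close> is the \<open>i\<close>-th largest element of
  \<open>pos_singular_values L\<close>, counted from 1 and without multiplicity.\<close>

definition sv :: "real^'n^'m \<Rightarrow> nat \<Rightarrow> real" where
  "sv L i = rev (sorted_list_of_set (pos_singular_values L)) ! (i - 1)"


section \<open>The primal-dual problem and the Chambolle--Pock algorithm\<close>

text \<open>\<open>(n+m)\<close>-vectors are pairs; the library's inner product on pairs is the Euclidean one.\<close>

definition T_PD ::
    "real^'n^'m \<Rightarrow> (real^'n \<Rightarrow> (real^'n) set) \<Rightarrow> (real^'m \<Rightarrow> (real^'m) set) \<Rightarrow>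
     (real^'n) \<times> (real^'m) \<Rightarrow> ((real^'n) \<times> (real^'m)) set" where
  "T_PD L A B = (\<lambda>(x, y).
     ((\<lambda>a. a + transpose L *v y) ` A x) \<times> ((\<lambda>b. b - L *v x) ` inv_op B y))"

definition V_mat ::
    "real^'n^'m \<Rightarrow> real \<Rightarrow> real \<Rightarrow> real \<Rightarrow> real \<Rightarrow>
     (real^'n) \<times> (real^'m) \<Rightarrow> (real^'n) \<times> (real^'m)" where
  "V_mat L \<beta>P \<beta>P' \<beta>D \<beta>D' = (\<lambda>(x, y).
     (\<beta>P *\<^sub>R orth_proj (rng (transpose L)) x + \<beta>P' *\<^sub>R orth_proj (ker L) x,
      \<beta>D *\<^sub>R orth_proj (rng L) y + \<beta>D' *\<^sub>R orth_proj (ker (transpose L)) y))"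

definition P_mat ::
    "real^'n^'m \<Rightarrow> real \<Rightarrow> real \<Rightarrow>
     (real^'n) \<times> (real^'m) \<Rightarrow> (real^'n) \<times> (real^'m)" where
  "P_mat L \<gamma> \<tau> = (\<lambda>(x, y).
     ((1 / \<gamma>) *\<^sub>R x - transpose L *v y, - (L *v x) + (1 / \<tau>) *\<^sub>R y))"

definition CPA ::
    "real^'n^'m \<Rightarrow> (real^'n \<Rightarrow> (real^'n) set) \<Rightarrow> (real^'m \<Rightarrow> (real^'m) set) \<Rightarrow>
     real \<Rightarrow> real \<Rightarrow> (nat \<Rightarrow> real) \<Rightarrow>
     (nat \<Rightarrow> real^'n) \<Rightarrow> (nat \<Rightarrow> real^'m) \<Rightarrow> (nat \<Rightarrow> real^'n) \<Rightarrow> (nat \<Rightarrow> real^'m) \<Rightarrow> bool" where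
  "CPA L A B \<gamma> \<tau> lam x y xb yb \<longleftrightarrow> (\<forall>k.
     xb k \<in> resolvent (scale_op \<gamma> A) (x k - \<gamma> *\<^sub>R (transpose L *v y k)) \<and>
     yb k \<in> resolvent (scale_op \<tau> (inv_op B)) (y k + \<tau> *\<^sub>R (L *v (2 *\<^sub>R xb k - x k))) \<and>
     x (Suc k) = x k + lam k *\<^sub>R (xb k - x k) \<and>
     y (Suc k) = y k + lam k *\<^sub>R (yb k - y k))"


section \<open>Parameters\<close>

text \<open>\<open>V_mat\<close> does not depend on \<open>\<beta>P'\<close> if \<open>ker L\<close> is trivial, nor on \<open>\<beta>D'\<close> if
  \<open>ker (transpose L)\<close> is; by convention the parameter then counts as \<open>\<infinity>\<close> in all other
  conditions.\<close>

definition ext_\<beta>P' :: "real^'n^'m \<Rightarrow> real \<Rightarrow> ereal" where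
  "ext_\<beta>P' (L::real^'n^'m) \<beta>P' = (if rank L = CARD('n) then \<infinity> else ereal \<beta>P')"

definition ext_\<beta>D' :: "real^'n^'m \<Rightarrow> real \<Rightarrow> ereal" where
  "ext_\<beta>D' (L::real^'n^'m) \<beta>D' = (if rank L = CARD('m) then \<infinity> else ereal \<beta>D')"

definition delta :: "real^'n^'m \<Rightarrow> real \<Rightarrow> real \<Rightarrow> real" where
  "delta L \<beta>P \<beta>D = 1 - neg_part (\<beta>P * \<beta>D) * ((opnorm L)\<^sup>2 - (sv L (num_sv L))\<^sup>2)"

definition beta_conditions ::
    "real^'n^'m \<Rightarrow> real \<Rightarrow> real \<Rightarrow> real \<Rightarrow> real \<Rightarrow> bool" where
  "beta_conditions L \<beta>P \<beta>P' \<beta>D \<beta>D' \<longleftrightarrow>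
     neg_part \<beta>P * neg_part \<beta>D < 1 / (4 * (opnorm L)\<^sup>2) \<and>
     (\<beta>P \<ge> 0 \<longrightarrow> ext_\<beta>P' L \<beta>P' \<ge> 0) \<and>
     (\<beta>P < 0 \<longrightarrow>
        ext_\<beta>P' L \<beta>P' \<ge> ereal (\<beta>P / (delta L \<beta>P \<beta>D - \<beta>P * \<beta>D * (opnorm L)\<^sup>2))) \<and>
     (\<beta>D \<ge> 0 \<longrightarrow> ext_\<beta>D' L \<beta>D' \<ge> 0) \<and>
     (\<beta>D < 0 \<longrightarrow>
        ext_\<beta>D' L \<beta>D' \<ge> ereal (\<beta>D / (delta L \<beta>P \<beta>D - \<beta>P * \<beta>D * (opnorm L)\<^sup>2)))"

definition \<gamma>_min :: "real^'n^'m \<Rightarrow> real \<Rightarrow> real \<Rightarrow> real" where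
  "\<gamma>_min L \<beta>P \<beta>D =
     (- 2 * \<beta>P) /
     (delta L \<beta>P \<beta>D + sqrt ((delta L \<beta>P \<beta>D)\<^sup>2 - 4 * \<beta>P * \<beta>D * (opnorm L)\<^sup>2))"

definition \<gamma>_max :: "real^'n^'m \<Rightarrow> real \<Rightarrow> real \<Rightarrow> real" where
  "\<gamma>_max L \<beta>P \<beta>D =
     (delta L \<beta>P \<beta>D + sqrt ((delta L \<beta>P \<beta>D)\<^sup>2 - 4 * \<beta>P * \<beta>D * (opnorm L)\<^sup>2)) /
     (- 2 * \<beta>D * (opnorm L)\<^sup>2)"

definition \<tau>_min :: "real^'n^'m \<Rightarrow> real \<Rightarrow> real \<Rightarrow> real \<Rightarrow> real" where
  "\<tau>_min L \<beta>P \<beta>D \<gamma> =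
     pos_part (- \<beta>D * (\<gamma> + \<beta>P)) /
     (\<gamma> * (delta L \<beta>P \<beta>D - \<beta>P * \<beta>D * (opnorm L)\<^sup>2) + \<beta>P)"

definition stepsize_rule ::
    "real^'n^'m \<Rightarrow> real \<Rightarrow> real \<Rightarrow> real \<Rightarrow> real \<Rightarrow> bool" where
  "stepsize_rule L \<beta>P \<beta>D \<gamma> \<tau> \<longleftrightarrow>
     (\<beta>P \<ge> 0 \<and> \<beta>D \<ge> 0 \<longrightarrow>
        \<gamma> \<in> {0<..} \<and> \<tau> \<in> {0<..1 / (\<gamma> * (opnorm L)\<^sup>2)}) \<and>
     (\<beta>P \<ge> 0 \<and> \<beta>D < 0 \<longrightarrow>
        \<gamma> \<in> {0<..<\<gamma>_max L \<beta>P \<beta>D} \<and>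
        \<tau> \<in> {\<tau>_min L \<beta>P \<beta>D \<gamma><..1 / (\<gamma> * (opnorm L)\<^sup>2)}) \<and>
     (\<beta>P < 0 \<and> \<beta>D \<ge> 0 \<longrightarrow>
        \<gamma> \<in> {\<gamma>_min L \<beta>P \<beta>D<..} \<and>
        \<tau> \<in> {\<tau>_min L \<beta>P \<beta>D \<gamma><..1 / (\<gamma> * (opnorm L)\<^sup>2)}) \<and>
     (\<beta>P < 0 \<and> \<beta>D < 0 \<longrightarrow>
        \<gamma> \<in> {\<gamma>_min L \<beta>P \<beta>D<..<\<gamma>_max L \<beta>P \<beta>D} \<and>
        \<tau> \<in> {\<tau>_min L \<beta>P \<beta>D \<gamma><..1 / (\<gamma> * (opnorm L)\<^sup>2)})"

definition Delta :: "real \<Rightarrow> real \<Rightarrow> real \<Rightarrow> real \<Rightarrow> real" where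
  "Delta \<beta>P \<beta>D \<gamma> \<tau> = 1 / (2 * \<gamma>) * \<beta>P + 1 / (2 * \<tau>) * \<beta>D"

definition theta :: "real \<Rightarrow> real \<Rightarrow> real \<Rightarrow> real \<Rightarrow> real \<Rightarrow> real" where
  "theta \<beta>P \<beta>D \<gamma> \<tau> \<sigma> =
     sqrt ((1 / (2 * \<gamma>) * \<beta>P - 1 / (2 * \<tau>) * \<beta>D)\<^sup>2 + \<beta>P * \<beta>D * \<sigma>\<^sup>2)"

text \<open>Under \<open>stepsize_rule\<close> the outer \<open>else\<close> branch means \<open>\<gamma> * \<tau> = 1 / (opnorm L)\<^sup>2\<close>, and
  for \<open>L \<noteq> 0\<close> its inner \<open>else\<close> branch means \<open>num_sv L > 1\<close>.\<close>

definition eta :: "real^'n^'m \<Rightarrow> real \<Rightarrow> real \<Rightarrow> real \<Rightarrow> real \<Rightarrow> real" where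
  "eta L \<beta>P \<beta>D \<gamma> \<tau> =
     (if \<gamma> * \<tau> < 1 / (opnorm L)\<^sup>2 then
        (if \<beta>P * \<beta>D < 0
         then Delta \<beta>P \<beta>D \<gamma> \<tau> - theta \<beta>P \<beta>D \<gamma> \<tau> (sv L (num_sv L))
         else Delta \<beta>P \<beta>D \<gamma> \<tau> - theta \<beta>P \<beta>D \<gamma> \<tau> (opnorm L))
      else if num_sv L = 1 then 2 * Delta \<beta>P \<beta>D \<gamma> \<tau>
      else
        (if \<beta>P * \<beta>D < 0
         then Delta \<beta>P \<beta>D \<gamma> \<tau> - theta \<beta>P \<beta>D \<gamma> \<tau> (sv L (num_sv L))
         else if min \<beta>P \<beta>D \<ge> 0
         then Delta \<beta>P \<beta>D \<gamma> \<tau> - theta \<beta>P \<beta>D \<gamma> \<tau> (sv L 2)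
         else 2 * Delta \<beta>P \<beta>D \<gamma> \<tau>))"

definition eta' :: "real^'n^'m \<Rightarrow> real \<Rightarrow> real \<Rightarrow> real \<Rightarrow> real \<Rightarrow> ereal" where
  "eta' L \<beta>P' \<beta>D' \<gamma> \<tau> =
     min (ereal (1 / \<gamma>) * ext_\<beta>P' L \<beta>P') (ereal (1 / \<tau>) * ext_\<beta>D' L \<beta>D')"

text \<open>For \<open>\<gamma>, \<tau> > 0\<close> the minimum below is finite, so \<open>real_of_ereal\<close> loses nothing.\<close>

definition eta_bar ::
    "real^'n^'m \<Rightarrow> real \<Rightarrow> real \<Rightarrow> real \<Rightarrow> real \<Rightarrow> real \<Rightarrow> real \<Rightarrow> real" where
  "eta_bar L \<beta>P \<beta>P' \<beta>D \<beta>D' \<gamma> \<tau> =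
     real_of_ereal (min (ereal (eta L \<beta>P \<beta>D \<gamma> \<tau>)) (eta' L \<beta>P' \<beta>D' \<gamma> \<tau>))"

lemma ereal_eta_bar:
  assumes "\<gamma> > 0" "\<tau> > 0"
  shows "ereal (eta_bar L \<beta>P \<beta>P' \<beta>D \<beta>D' \<gamma> \<tau>) =
    min (ereal (eta L \<beta>P \<beta>D \<gamma> \<tau>)) (eta' L \<beta>P' \<beta>D' \<gamma> \<tau>)"
  using assms unfolding eta_bar_def eta'_def ext_\<beta>P'_def ext_\<beta>D'_def
  by (auto simp: min_def)

definition relaxation_rule ::
    "real^'n^'m \<Rightarrow> real \<Rightarrow> real \<Rightarrow> real \<Rightarrow> real \<Rightarrow> real \<Rightarrow> real \<Rightarrow> (nat \<Rightarrow> real) \<Rightarrow> bool" where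
  "relaxation_rule L \<beta>P \<beta>P' \<beta>D \<beta>D' \<gamma> \<tau> lam \<longleftrightarrow>
     (let \<eta>b = eta_bar L \<beta>P \<beta>P' \<beta>D \<beta>D' \<gamma> \<tau> in
       (\<forall>k. lam k \<in> {0<..<2 * (1 + \<eta>b)}) \<and>
       liminf (\<lambda>k. ereal (lam k * (2 * (1 + \<eta>b) - lam k))) > 0)"

definition uniformly_bounded_in :: "(nat \<Rightarrow> real) \<Rightarrow> real \<Rightarrow> real \<Rightarrow> bool" where
  "uniformly_bounded_in s a b \<longleftrightarrow> (\<exists>c d. a < c \<and> c \<le> d \<and> d < b \<and> range s \<subseteq> {c..d})"

definition seq_limit_point :: "(nat \<Rightarrow> 'a::topological_space) \<Rightarrow> 'a \<Rightarrow> bool" where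
  "seq_limit_point u l \<longleftrightarrow> (\<exists>r::nat \<Rightarrow> nat. strict_mono r \<and> (u \<circ> r) \<longlonglongrightarrow> l)"

end

theory Submission
  imports Defs
begin

text \<open>CPA is the proximal point iteration preconditioned by \<open>P\<close>, which is positive semidefinite
  under the stepsize rule. Expanding in singular vectors of \<open>L\<close> splits the inequality
  \<open>P V P \<ge> \<eta> P\<close> into \<open>2 \<times> 2\<close> blocks, and the value of \<open>\<eta>\<close> is what makes them all
  positive semidefinite. Together with the oblique Minty inequality this gives Fejer monotonicity in
  the seminorm of \<open>P\<close>, with residuals tending to zero. When \<open>P\<close> is singular, boundedness of \<open>zb\<close>
  is not automatic; it holds because \<open>P V P \<ge> \<eta> P\<close> with \<open>\<eta> > -1\<close>, applied to vectors
  supported in one block, makes both resolvents locally bounded.\<close>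

subsection \<open>Linear algebra\<close>

text \<open>On the block of a singular value \<sigma> put r^2 = \<gamma> \<tau> \<sigma>^2. The best
  constant there is a generalized eigenvalue: the determinant of \<open>P V P - \<eta> P\<close>, as
  a polynomial in \<eta>, has the roots \<open>Delta - theta\<close> and
  \<open>Delta + theta\<close>, and the smaller one is the bound. At r = 1 the block of
  \<open>P\<close> drops to rank one, and only \<open>\<eta> \<le> 2 * Delta\<close> remains. This
  can happen for the largest singular value alone, which is why \<open>eta\<close> then turns to the
  second one and why a single singular value is a case of its own. The seminorm of \<open>P\<close>
  does not see the kernel of \<open>P\<close>. Monotonicity controls \<open>P z\<close> and the
  projection of \<open>z\<close> only, and a limit of projections need not come from a limit of
  points. Boundedness of \<open>zb\<close> repairs this: subsequences of \<open>zb\<close> converge,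
  and the closed graph makes their limits zeros. It can be had without control of \<open>z\<close>,
  because the first resolvent is evaluated at \<gamma> times the first component of
  \<open>P z\<close>, and the second at a point that depends only on the second component and on
  \<open>xb\<close>.\<close>

lemma psd_Cauchy_Schwarz:
  fixes h :: "'a::real_inner \<Rightarrow> 'a"
  assumes h: "linear h" and W: "subspace W"
    and sym: "\<And>x y. x \<in> W \<Longrightarrow> y \<in> W \<Longrightarrow> h x \<bullet> y = x \<bullet> h y"
    and psd: "\<And>x. x \<in> W \<Longrightarrow> 0 \<le> x \<bullet> h x"
    and u: "u \<in> W" and w: "w \<in> W"
  shows "(u \<bullet> h w)\<^sup>2 \<le> (u \<bullet> h u) * (w \<bullet> h w)"
proof -
  have q: "0 \<le> s\<^sup>2 * (u \<bullet> h u) + 2 * s * t * (u \<bullet> h w) + t\<^sup>2 * (w \<bullet> h w)" for s t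
  proof -
    have "s *\<^sub>R u + t *\<^sub>R w \<in> W" using W u w by (simp add: subspace_add subspace_scale)
    from psd[OF this] show ?thesis using sym[OF u w]
      by (simp add: linear_add[OF h] linear_scale[OF h] inner_simps power2_eq_square
          inner_commute algebra_simps)
  qed
  show ?thesis
  proof (cases "w \<bullet> h w = 0")
    case True
    have "u \<bullet> h w = 0"
    proof (rule ccontr)
      assume "u \<bullet> h w \<noteq> 0"
      \<comment> \<open>With this multiple of \<open>w\<close> the quadratic polynomial takes the
        value -1.\<close>
      then show False
        using q[of 1 "- (u \<bullet> h u + 1) / (2 * (u \<bullet> h w))"] True psd[OF u]
        by (simp add: field_simps)
    qed
    then show ?thesis using psd[OF u] psd[OF w] by simp
  next
    case False
    then have pos: "w \<bullet> h w > 0" using psd[OF w] by simp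
    have "0 \<le> (w \<bullet> h w) * ((w \<bullet> h w) * (u \<bullet> h u) - (u \<bullet> h w)\<^sup>2)"
      using q[of "w \<bullet> h w" "- (u \<bullet> h w)"] by (simp add: power2_eq_square algebra_simps)
    then show ?thesis using pos by (simp add: zero_le_mult_iff mult.commute)
  qed
qed

text \<open>Cauchy-Schwarz for the form of \<open>P\<close>, applied to \<open>u\<close> and
  \<open>P u\<close>, has |P u|^4 on the left, and one factor |P u|^2 cancels. This turns a
  vanishing seminorm into a vanishing \<open>P u\<close> without a square root of
  \<open>P\<close>.\<close>

lemma psd_norm_le:
  fixes P :: "'a::euclidean_space \<Rightarrow> 'a"
  assumes P: "linear P" and sym: "\<And>x y. P x \<bullet> y = x \<bullet> P y" and psd: "\<And>x. 0 \<le> x \<bullet> P x"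
  shows "(norm (P u))\<^sup>2 \<le> onorm P * (u \<bullet> P u)"
proof (cases "P u = 0")
  case True
  then show ?thesis by simp
next
  case False
  have bl: "bounded_linear P" using P by (rule linear_conv_bounded_linear[THEN iffD1])
  have "((norm (P u))\<^sup>2)\<^sup>2 = (u \<bullet> P (P u))\<^sup>2"
    by (simp add: power2_norm_eq_inner flip: sym)
  also have "\<dots> \<le> (u \<bullet> P u) * (P u \<bullet> P (P u))"
    using psd_Cauchy_Schwarz[OF P subspace_UNIV] sym psd by blast
  also have "\<dots> \<le> (u \<bullet> P u) * (onorm P * (norm (P u))\<^sup>2)"
  proof (rule mult_left_mono[OF _ psd])
    have "P u \<bullet> P (P u) \<le> norm (P u) * norm (P (P u))" by (rule norm_cauchy_schwarz)
    also have "\<dots> \<le> norm (P u) * (onorm P * norm (P u))"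
      by (rule mult_left_mono[OF onorm[OF bl]]) simp
    finally show "P u \<bullet> P (P u) \<le> onorm P * (norm (P u))\<^sup>2"
      by (simp add: power2_eq_square algebra_simps)
  qed
  finally have "(norm (P u))\<^sup>2 * (norm (P u))\<^sup>2 \<le> (onorm P * (u \<bullet> P u)) * (norm (P u))\<^sup>2"
    by (simp add: power2_eq_square algebra_simps)
  then show ?thesis using False by (metis mult_le_cancel_right norm_eq_zero not_le zero_less_power2)
qed

text \<open>If \<open>u\<close> maximizes the Rayleigh quotient on the unit sphere of
  \<open>W\<close>, with maximum c, then c - f is positive semidefinite on \<open>W\<close> and
  \<open>u\<close> has seminorm zero for it. Cauchy-Schwarz forces (c - f) u = 0, so no derivative
  is taken. The invariant subspace allows application to the complement of eigenvectors already
  found.\<close>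

lemma self_adjoint_has_eigenvector:
  fixes f :: "'a::euclidean_space \<Rightarrow> 'a"
  assumes f: "linear f" and sym: "\<And>x y. f x \<bullet> y = x \<bullet> f y"
    and W: "subspace W" and inv: "\<And>x. x \<in> W \<Longrightarrow> f x \<in> W" and ne: "W \<noteq> {0}"
  obtains u c where "u \<in> W" "norm u = 1" "f u = c *\<^sub>R u"
proof -
  have cont: "continuous_on UNIV f" using f by (rule linear_continuous_on[OF linear_conv_bounded_linear[THEN iffD1]])
  let ?K = "sphere 0 1 \<inter> W"
  have "compact ?K" by (intro compact_Int_closed compact_sphere closed_subspace W)
  moreover have "?K \<noteq> {}"
  proof -
    obtain w where "w \<in> W" "w \<noteq> 0" using ne W subspace_0 by blast
    then have "w /\<^sub>R norm w \<in> ?K" using W by (simp add: subspace_scale)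
    then show ?thesis by blast
  qed
  moreover have "continuous_on ?K (\<lambda>x. x \<bullet> f x)"
    by (intro continuous_intros continuous_on_subset[OF cont]) auto
  ultimately obtain u where u: "u \<in> ?K" and max: "\<And>y. y \<in> ?K \<Longrightarrow> y \<bullet> f y \<le> u \<bullet> f u"
    using continuous_attains_sup by (metis (no_types, lifting))
  define c where "c = u \<bullet> f u"
  define h where "h = (\<lambda>x. c *\<^sub>R x - f x)"
  have h: "linear h" unfolding h_def using f
    by (intro linear_compose_sub linear_compose_scale_right linear_ident)
  have hsym: "h x \<bullet> y = x \<bullet> h y" for x y
    unfolding h_def by (simp add: inner_diff sym)
  have psd: "0 \<le> x \<bullet> h x" if "x \<in> W" for x
  proof (cases "x = 0")
    case False
    have "x /\<^sub>R norm x \<in> ?K" using False W that by (simp add: subspace_scale)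
    from max[OF this] show ?thesis using False unfolding h_def c_def[symmetric]
      by (simp add: linear_scale[OF f] inner_diff field_simps dot_square_norm power2_eq_square)
  qed simp
  have uW: "u \<in> W" "norm u = 1" using u by auto
  have "u \<bullet> h u = 0"
    using uW by (simp add: h_def c_def inner_diff dot_square_norm)
  moreover have hu: "h u \<in> W" using uW inv W by (simp add: h_def subspace_diff subspace_scale)
  ultimately have "(h u \<bullet> h u)\<^sup>2 \<le> 0"
    using psd_Cauchy_Schwarz[OF h W _ psd uW(1) hu] hsym by auto
  then have "h u = 0" by simp
  then show ?thesis using that[of u c] uW by (simp add: h_def)
qed

text \<open>Take an orthonormal set of eigenvectors of largest cardinality. Its orthogonal
  complement is invariant because \<open>f\<close> is self-adjoint, so an eigenvector in it would
  enlarge the set. The basis property is exported as Parseval's identity, the form in which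
  quadratic forms are expanded later.\<close>

theorem self_adjoint_orthonormal_eigenbasis:
  fixes f :: "'a::euclidean_space \<Rightarrow> 'a"
  assumes f: "linear f" and sym: "\<And>x y. f x \<bullet> y = x \<bullet> f y"
  obtains B where "finite B" "\<And>b. b \<in> B \<Longrightarrow> norm b = 1" "\<And>b. b \<in> B \<Longrightarrow> \<exists>c. f b = c *\<^sub>R b"
    "\<And>x y. x \<bullet> y = (\<Sum>b\<in>B. (x \<bullet> b) * (y \<bullet> b))"
proof -
  define E where "E B \<longleftrightarrow> pairwise orthogonal B \<and> (\<forall>b\<in>B. norm b = 1 \<and> (\<exists>c. f b = c *\<^sub>R b))" for B
  have bound: "finite B \<and> card B \<le> DIM('a)" if "E B" for B
  proof -
    have "independent B" using that unfolding E_def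
      by (intro pairwise_orthogonal_independent) (metis norm_zero zero_neq_one)+
    then show ?thesis by (simp add: independent_bound)
  qed
  have "E {}" by (simp add: E_def)
  moreover have "\<forall>B. E B \<longrightarrow> card B < Suc DIM('a)" using bound by (simp add: less_Suc_eq_le)
  ultimately have "\<exists>B. E B \<and> (\<forall>C. E C \<longrightarrow> card C \<le> card B)"
    by (rule ex_has_greatest_nat)
  then obtain B where B: "E B" and mx: "\<And>C. E C \<Longrightarrow> card C \<le> card B" by blast
  have fin: "finite B" using bound[OF B] by simp
  define W where "W = (span B)\<^sup>\<bottom>"
  have W: "subspace W" unfolding W_def by (rule subspace_orthogonal_comp)
  have W_iff: "x \<in> W \<longleftrightarrow> (\<forall>b\<in>B. b \<bullet> x = 0)" for x
  proof
    assume "x \<in> W"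
    then show "\<forall>b\<in>B. b \<bullet> x = 0"
      unfolding W_def orthogonal_comp_def orthogonal_def using span_base by blast
  next
    assume "\<forall>b\<in>B. b \<bullet> x = 0"
    then have "orthogonal x b" if "b \<in> B" for b
      using that by (simp add: orthogonal_def inner_commute)
    then have "orthogonal x y" if "y \<in> span B" for y
      using that orthogonal_to_span by blast
    then show "x \<in> W"
      unfolding W_def orthogonal_comp_def by (simp add: orthogonal_commute)
  qed
  have "f x \<in> W" if "x \<in> W" for x
    unfolding W_iff
  proof
    fix b assume b: "b \<in> B"
    obtain c where "f b = c *\<^sub>R b" using b B by (auto simp: E_def)
    then show "b \<bullet> f x = 0" using that b sym[of b x] by (simp add: W_iff)
  qed
  note inv = this
  have W0: "W = {0}"
  proof (rule ccontr)
    assume "W \<noteq> {0}"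
    then obtain u c where u: "u \<in> W" "norm u = 1" "f u = c *\<^sub>R u"
      using self_adjoint_has_eigenvector[OF f sym W inv] by blast
    then have "u \<notin> B" by (metis W_iff inner_eq_zero_iff norm_zero zero_neq_one)
    moreover have "E (insert u B)"
      using B u unfolding E_def W_iff
      by (auto simp: pairwise_insert orthogonal_def inner_commute)
    ultimately show False using mx[of "insert u B"] fin by simp
  qed
  have orth: "b \<bullet> b' = (if b = b' then 1 else 0)" if "b \<in> B" "b' \<in> B" for b b'
    using B that by (auto simp: E_def pairwise_def orthogonal_def dot_square_norm)
  have expand: "x = (\<Sum>b\<in>B. (x \<bullet> b) *\<^sub>R b)" for x
  proof -
    have "x - (\<Sum>b\<in>B. (x \<bullet> b) *\<^sub>R b) \<in> W"
      unfolding W_iff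
    proof
      fix b assume b: "b \<in> B"
      have "b \<bullet> (\<Sum>b\<in>B. (x \<bullet> b) *\<^sub>R b) = (\<Sum>b'\<in>B. if b = b' then x \<bullet> b' else 0)"
        unfolding inner_sum_right using b by (intro sum.cong) (auto simp: orth)
      then show "b \<bullet> (x - (\<Sum>b\<in>B. (x \<bullet> b) *\<^sub>R b)) = 0"
        using b fin by (simp add: inner_diff_right inner_commute)
    qed
    then show ?thesis using W0 by simp
  qed
  have "x \<bullet> y = (\<Sum>b\<in>B. (x \<bullet> b) * (y \<bullet> b))" for x y
    by (subst expand[of x], unfold inner_sum_left inner_scaleR_left)
      (intro sum.cong refl, simp add: inner_commute)
  then show ?thesis
  proof (rule that[OF fin, rotated 2])
    show "norm b = 1" "\<exists>c. f b = c *\<^sub>R b" if "b \<in> B" for b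
      using B that unfolding E_def by blast+
  qed
qed

subsection \<open>The preconditioned proximal point iteration\<close>

lemma subspace_range_linear:
  "linear f \<Longrightarrow> subspace (range f)"
  by (metis linear_subspace_image subspace_UNIV)

lemma orth_proj_decomp:
  assumes "subspace E"
  shows "orth_proj E x \<in> E" "x - orth_proj E x \<in> E\<^sup>\<bottom>"
proof -
  obtain p q where "p \<in> E" "q \<in> E\<^sup>\<bottom>" "x = p + q"
    using subspace_sum_orthogonal_comp[OF assms] by (metis UNIV_I set_plus_elim)
  moreover from this have "orth_proj E x = p"
    by (intro orth_proj_eqI[OF assms]) auto
  ultimately show "orth_proj E x \<in> E" "x - orth_proj E x \<in> E\<^sup>\<bottom>" by auto
qed

lemma linear_orth_proj:
  assumes "subspace E"
  shows "linear (orth_proj E)"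
proof (rule linearI)
  note d = orth_proj_decomp[OF assms]
  show "orth_proj E (x + y) = orth_proj E x + orth_proj E y" for x y
    using subspace_add[OF subspace_orthogonal_comp d(2)[of x] d(2)[of y]] d(1) assms
    by (intro orth_proj_eqI) (auto intro: subspace_add simp: algebra_simps)
  show "orth_proj E (c *\<^sub>R x) = c *\<^sub>R orth_proj E x" for c x
    using subspace_scale[OF subspace_orthogonal_comp d(2)[of x], of c] d(1) assms
    by (intro orth_proj_eqI) (auto intro: subspace_scale simp: algebra_simps)
qed

text \<open>The convergence analysis sees the algorithm only through the inclusion of the residuals,
  the relaxed step and \<open>P V P \<ge> \<eta> P\<close>. Since \<open>P\<close> may be singular,
  \<open>z\<close> is controlled only modulo the kernel of \<open>P\<close>.\<close>

locale oblique_pppa =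
  fixes P V :: "'a::euclidean_space \<Rightarrow> 'a" and T :: "'a \<Rightarrow> 'a set" and S :: "'a set"
    and \<eta> :: real and lam :: "nat \<Rightarrow> real" and z zb :: "nat \<Rightarrow> 'a"
  assumes P: "linear P" and V: "linear V"
    and P_sym: "P u \<bullet> w = u \<bullet> P w"
    and P_psd: "0 \<le> u \<bullet> P u"
    and closed_T: "closed (gph T)"
    and Minty: "oblique_weak_Minty V T S"
    and oblique: "\<eta> * (u \<bullet> P u) \<le> P u \<bullet> V (P u)"
    and lam: "0 < lam k" "lam k < 2 * (1 + \<eta>)"
    and lam_liminf: "liminf (\<lambda>k. ereal (lam k * (2 * (1 + \<eta>) - lam k))) > 0"
    and incl: "P (z k - zb k) \<in> T (zb k)"
    and step: "z (Suc k) = z k + lam k *\<^sub>R (zb k - z k)"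
begin

abbreviation "proj \<equiv> orth_proj (range P)"

lemma bounded_linear_P: "bounded_linear P"
  using P by (simp add: linear_conv_bounded_linear)

lemma bounded_linear_proj: "bounded_linear proj"
  using linear_orth_proj[OF subspace_range_linear[OF P]] by (simp add: linear_conv_bounded_linear)

lemma P_norm_le: "(norm (P u))\<^sup>2 \<le> onorm P * (u \<bullet> P u)"
  by (rule psd_norm_le[OF P P_sym P_psd])

text \<open>For self-adjoint \<open>P\<close> the orthogonal complement of the range is the kernel,
  so \<open>P\<close> does not see what \<open>proj\<close> removes.\<close>

lemma P_proj: "P (proj u) = P u"
proof -
  have "u - proj u \<in> (range P)\<^sup>\<bottom>"
    by (rule orth_proj_decomp(2)[OF subspace_range_linear[OF P]])
  then have "P (P (u - proj u)) \<bullet> (u - proj u) = 0"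
    by (auto simp: orthogonal_comp_def orthogonal_def)
  then have "P (u - proj u) = 0" by (simp only: P_sym[of "P (u - proj u)"] inner_eq_zero_iff)
  then show ?thesis by (simp add: linear_diff[OF P])
qed

text \<open>\<open>P\<close> is injective on its range, as range and kernel are orthogonal; in
  finite dimension it is then bounded below there, and \<open>c\<close> is the reciprocal of that
  bound.\<close>

lemma proj_bound:
  obtains c where "c > 0" "\<And>u. norm (proj u) \<le> c * norm (P u)"
proof -
  have sub: "subspace (range P)" by (rule subspace_range_linear[OF P])
  have "w = 0" if w: "w \<in> range P" "P w = 0" for w
  proof -
    obtain v where v: "w = P v" using w(1) by blast
    have "w \<bullet> w = v \<bullet> P w" using v P_sym by simp
    then show ?thesis using w(2) by simp
  qed
  then obtain e where e: "e > 0" "\<forall>w\<in>range P. e * norm w \<le> norm (P w)"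
    using injective_imp_isometric[OF closed_subspace[OF sub] sub bounded_linear_P] by (auto simp: mult.commute)
  show ?thesis
  proof (rule that[of "1 / e"])
    show "norm (proj u) \<le> 1 / e * norm (P u)" for u
      using e(2)[rule_format, OF orth_proj_decomp(1)[OF sub, of u]] e(1)
      by (simp add: P_proj field_simps)
  qed (use e in simp)
qed

lemma tendsto_proj_0:
  assumes "(\<lambda>k. P (u k)) \<longlonglongrightarrow> 0"
  shows "(\<lambda>k. proj (u k)) \<longlonglongrightarrow> 0"
proof -
  obtain c where c: "c > 0" "\<And>u. norm (proj u) \<le> c * norm (P u)" by (rule proj_bound) blast
  show ?thesis
    by (rule Lim_null_comparison[where g = "\<lambda>k. c * norm (P (u k))"])
      (use c tendsto_mult_right_zero[OF tendsto_norm_zero[OF assms]] in auto)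
qed

text \<open>With w = z k - zb k and e = z k - zs, the Minty inequality at \<open>zb k\<close> and
  \<open>oblique\<close> give (1 + \<eta>) <w, P w> \<le> <e, P w>, because zb k - zs = e - w. This
  bounds the cross term in the squared seminorm of e - lam k w and is the origin of the factor 2 (1
  + \<eta>) - lam k.\<close>

lemma Fejer:
  assumes "zs \<in> S"
  shows "(z (Suc k) - zs) \<bullet> P (z (Suc k) - zs) \<le>
    (z k - zs) \<bullet> P (z k - zs) - lam k * (2 * (1 + \<eta>) - lam k) * ((z k - zb k) \<bullet> P (z k - zb k))"
proof -
  define w where "w = z k - zb k"
  define e where "e = z k - zs"
  have "P w \<bullet> (zb k - zs) \<ge> P w \<bullet> V (P w)"
    using Minty assms incl[of k] unfolding oblique_weak_Minty_def gph_def w_def by blast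
  then have "P w \<bullet> (e - w) \<ge> \<eta> * (w \<bullet> P w)"
    using oblique[of w] by (simp add: e_def w_def)
  then have "(1 + \<eta>) * (w \<bullet> P w) \<le> e \<bullet> P w"
    by (simp add: inner_diff_right algebra_simps inner_commute)
  then have "2 * lam k * ((1 + \<eta>) * (w \<bullet> P w)) \<le> 2 * lam k * (e \<bullet> P w)"
    using lam(1)[of k] by (intro mult_left_mono) auto
  moreover have eq: "z (Suc k) - zs = e - lam k *\<^sub>R w"
    by (simp add: step e_def w_def algebra_simps)
  moreover have "(e - lam k *\<^sub>R w) \<bullet> P (e - lam k *\<^sub>R w) =
      e \<bullet> P e - 2 * lam k * (e \<bullet> P w) + lam k * lam k * (w \<bullet> P w)"
    using P_sym[of e w] by (simp add: linear_diff[OF P] linear_scale[OF P] inner_simps inner_commute algebra_simps)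
  ultimately show ?thesis unfolding eq e_def[symmetric] w_def[symmetric]
    by (simp add: algebra_simps)
qed

lemma seminorm_decreasing:
  assumes "zs \<in> S"
  shows "decseq (\<lambda>k. (z k - zs) \<bullet> P (z k - zs))"
proof (rule decseq_SucI)
  fix k
  have "0 \<le> lam k * (2 * (1 + \<eta>) - lam k) * ((z k - zb k) \<bullet> P (z k - zb k))"
    using lam[of k] P_psd by (intro mult_nonneg_nonneg) auto
  then show "(z (Suc k) - zs) \<bullet> P (z (Suc k) - zs) \<le> (z k - zs) \<bullet> P (z k - zs)"
    using Fejer[OF assms, of k] by simp
qed

lemma seminorm_convergent:
  assumes "zs \<in> S"
  shows "convergent (\<lambda>k. (z k - zs) \<bullet> P (z k - zs))"
  using decseq_convergent[OF seminorm_decreasing[OF assms]] P_psd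
  by (metis convergent_def)

lemma S_nonempty: "S \<noteq> {}" and S_subset: "S \<subseteq> zer T"
  using Minty by (auto simp: oblique_weak_Minty_def)

text \<open>The liminf condition puts a fixed \<epsilon> > 0 below the Fejer coefficient for all
  large k, so the residual is at most 1 / \<epsilon> times the drop of a convergent sequence between
  consecutive indices.\<close>

lemma seminorm_residual_tendsto_0: "(\<lambda>k. (z k - zb k) \<bullet> P (z k - zb k)) \<longlonglongrightarrow> 0"
proof -
  obtain zs where zs: "zs \<in> S" using S_nonempty by blast
  let ?N = "\<lambda>k. (z k - zs) \<bullet> P (z k - zs)"
  obtain l where l: "?N \<longlonglongrightarrow> l" using seminorm_convergent[OF zs] by (auto simp: convergent_def)
  then have d: "(\<lambda>k. ?N k - ?N (Suc k)) \<longlonglongrightarrow> 0"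
    using tendsto_diff[OF l LIMSEQ_Suc[OF l]] by simp
  obtain \<epsilon> where \<epsilon>: "0 < ereal \<epsilon>" "ereal \<epsilon> < liminf (\<lambda>k. ereal (lam k * (2 * (1 + \<eta>) - lam k)))"
    using ereal_dense2[OF lam_liminf] by blast
  have ev: "eventually (\<lambda>k. \<epsilon> < lam k * (2 * (1 + \<eta>) - lam k)) sequentially"
    using less_LiminfD[OF \<epsilon>(2)] by simp
  show ?thesis
  proof (rule Lim_null_comparison[where g = "\<lambda>k. (?N k - ?N (Suc k)) / \<epsilon>"])
    show "(\<lambda>k. (?N k - ?N (Suc k)) / \<epsilon>) \<longlonglongrightarrow> 0"
      using tendsto_divide_zero[OF d] .
    show "eventually (\<lambda>k. norm ((z k - zb k) \<bullet> P (z k - zb k)) \<le> (?N k - ?N (Suc k)) / \<epsilon>) sequentially"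
      using ev
    proof eventually_elim
      case (elim k)
      have "\<epsilon> * ((z k - zb k) \<bullet> P (z k - zb k)) \<le>
          lam k * (2 * (1 + \<eta>) - lam k) * ((z k - zb k) \<bullet> P (z k - zb k))"
        using elim P_psd by (intro mult_right_mono) auto
      then have "\<epsilon> * ((z k - zb k) \<bullet> P (z k - zb k)) \<le> ?N k - ?N (Suc k)"
        using Fejer[OF zs, of k] by linarith
      then show ?case using \<epsilon>(1) P_psd[of "z k - zb k"] by (simp add: field_simps)
    qed
  qed
qed

lemma P_tendsto_0:
  assumes "(\<lambda>k. u k \<bullet> P (u k)) \<longlonglongrightarrow> 0"
  shows "(\<lambda>k. P (u k)) \<longlonglongrightarrow> 0"
proof -
  have "(\<lambda>k. (norm (P (u k)))\<^sup>2) \<longlonglongrightarrow> 0"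
    by (rule Lim_null_comparison[where g = "\<lambda>k. onorm P * (u k \<bullet> P (u k))"])
      (use P_norm_le tendsto_mult_right_zero[OF assms] in auto)
  then show ?thesis
    using tendsto_norm_zero_cancel by (fastforce intro: power_tendsto_0_iff[THEN iffD1, of 2])
qed

lemma residual_tendsto_0: "(\<lambda>k. P (z k - zb k)) \<longlonglongrightarrow> 0"
  by (rule P_tendsto_0[OF seminorm_residual_tendsto_0])

lemma bounded_P_z: "bounded (range (\<lambda>k. P (z k)))"
proof -
  obtain zs where zs: "zs \<in> S" using S_nonempty by blast
  define M where "M = sqrt (onorm P * ((z 0 - zs) \<bullet> P (z 0 - zs)))"
  have "norm (P (z k)) \<le> M + norm (P zs)" for k
  proof -
    have "(norm (P (z k - zs)))\<^sup>2 \<le> onorm P * ((z k - zs) \<bullet> P (z k - zs))" by (rule P_norm_le)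
    also have "\<dots> \<le> onorm P * ((z 0 - zs) \<bullet> P (z 0 - zs))"
      using seminorm_decreasing[OF zs] onorm_pos_le[OF bounded_linear_P]
      by (intro mult_left_mono) (auto simp: decseq_def)
    finally have "norm (P (z k - zs)) \<le> M" unfolding M_def by (rule real_le_rsqrt)
    then show ?thesis
      using norm_triangle_ineq[of "P (z k - zs)" "P zs"] by (simp add: linear_diff[OF P])
  qed
  then show ?thesis by (auto simp: bounded_iff)
qed

lemma proj_diff_tendsto_0: "(\<lambda>k. proj (z k) - proj (zb k)) \<longlonglongrightarrow> 0"
  using tendsto_proj_0[OF residual_tendsto_0] linear_diff[OF bounded_linear.linear[OF bounded_linear_proj]]
  by simp

lemma bounded_proj_z: "bounded (range (\<lambda>k. proj (z k)))"
proof -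
  obtain c where c: "c > 0" "\<And>u. norm (proj u) \<le> c * norm (P u)" by (rule proj_bound) blast
  obtain M where M: "\<And>k. norm (P (z k)) \<le> M" using bounded_P_z by (auto simp: bounded_iff)
  have "norm (proj (z k)) \<le> c * M" for k
    using c(2)[of "z k"] mult_left_mono[OF M[of k], of c] c(1) by linarith
  then show ?thesis by (auto simp: bounded_iff)
qed

lemma bounded_proj_zb: "bounded (range (\<lambda>k. proj (zb k)))"
proof -
  have "bounded (range (\<lambda>k. proj (z k) - proj (zb k)))"
    using proj_diff_tendsto_0 by (rule convergent_imp_bounded)
  from bounded_minus_comp[OF bounded_proj_z this] show ?thesis by simp
qed

lemma limit_point_zer:
  assumes "seq_limit_point zb l"
  shows "l \<in> zer T"
proof -
  obtain r where r: "strict_mono r" "(zb \<circ> r) \<longlonglongrightarrow> l"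
    using assms by (auto simp: seq_limit_point_def)
  have lim: "(\<lambda>k. ((zb \<circ> r) k, ((\<lambda>k. P (z k - zb k)) \<circ> r) k)) \<longlonglongrightarrow> (l, 0)"
    by (intro tendsto_Pair r LIMSEQ_subseq_LIMSEQ[OF residual_tendsto_0 r(1)])
  have mem: "((zb \<circ> r) k, ((\<lambda>k. P (z k - zb k)) \<circ> r) k) \<in> gph T" for k
    using incl by (simp add: gph_def)
  have "(l, 0) \<in> gph T"
    using closed_sequentially[OF closed_T mem lim] .
  then show ?thesis by (simp add: gph_def zer_def)
qed

text \<open>Convergent projections leave the kernel components of \<open>zb\<close> free.
  Boundedness gives a further subsequence along which \<open>zb\<close> itself converges; its limit
  is a zero with the required projection.\<close>

lemma limit_point_proj_zb:
  assumes bdd: "bounded (range zb)" and l: "seq_limit_point (\<lambda>k. proj (zb k)) l"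
  shows "l \<in> proj ` zer T"
proof -
  obtain r where r: "strict_mono r" "(\<lambda>k. proj (zb (r k))) \<longlonglongrightarrow> l"
    using l by (auto simp: seq_limit_point_def o_def)
  have "bounded (range (zb \<circ> r))" using bdd by (rule bounded_subset) auto
  then obtain p q where q: "strict_mono q" "((zb \<circ> r) \<circ> q) \<longlonglongrightarrow> p"
    using bounded_imp_convergent_subsequence by blast
  have "p \<in> zer T"
    using q strict_mono_o[OF r(1) q(1)]
    by (intro limit_point_zer) (auto simp: seq_limit_point_def o_assoc)
  moreover have "(\<lambda>k. proj (zb (r (q k)))) \<longlonglongrightarrow> proj p"
    using bounded_linear.tendsto[OF bounded_linear_proj q(2)] by (simp add: o_def)
  then have "l = proj p"
    using LIMSEQ_subseq_LIMSEQ[OF r(2) q(1)] by (intro LIMSEQ_unique) (simp_all add: o_def)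
  ultimately show ?thesis by blast
qed

lemma limit_point_proj_z:
  assumes bdd: "bounded (range zb)" and l: "seq_limit_point (\<lambda>k. proj (z k)) l"
  shows "l \<in> proj ` zer T"
proof (rule limit_point_proj_zb[OF bdd])
  obtain r where r: "strict_mono r" "(\<lambda>k. proj (z (r k))) \<longlonglongrightarrow> l"
    using l by (auto simp: seq_limit_point_def o_def)
  have "(\<lambda>k. proj (z (r k)) - (proj (z (r k)) - proj (zb (r k)))) \<longlonglongrightarrow> l - 0"
    using tendsto_diff[OF r(2) LIMSEQ_subseq_LIMSEQ[OF proj_diff_tendsto_0 r(1), unfolded o_def]] .
  then show "seq_limit_point (\<lambda>k. proj (zb k)) l"
    using r(1) by (auto simp: seq_limit_point_def o_def)
qed

text \<open>An Opial-type argument in the seminorm of \<open>P\<close>. A limit point of the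
  projections is the projection of a zero, and the hypothesis on \<open>S\<close> exchanges that
  zero for one in \<open>S\<close>, to which the seminorm distance is monotone. The distance
  vanishes along a subsequence, hence along the whole sequence.\<close>

lemma P_z_convergent:
  assumes bdd: "bounded (range zb)" and S: "proj ` S = proj ` zer T"
  obtains zs where "zs \<in> S" "(\<lambda>k. P (z k - zs)) \<longlonglongrightarrow> 0"
proof -
  obtain l r where r: "strict_mono r" "((\<lambda>k. proj (z k)) \<circ> r) \<longlonglongrightarrow> l"
    using bounded_imp_convergent_subsequence[OF bounded_proj_z] by blast
  then have "l \<in> proj ` S"
    using limit_point_proj_z[OF bdd] S by (auto simp: seq_limit_point_def)
  then obtain zs where zs: "zs \<in> S" "l = proj zs" by blast
  let ?N = "\<lambda>k. (z k - zs) \<bullet> P (z k - zs)"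
  have N: "u \<bullet> P u = proj u \<bullet> P (proj u)" for u
    by (metis P_proj P_sym)
  have "(\<lambda>k. proj (z (r k) - zs)) \<longlonglongrightarrow> 0"
    using tendsto_diff[OF r(2) tendsto_const[of l]] zs
      linear_diff[OF bounded_linear.linear[OF bounded_linear_proj]] by (simp add: o_def)
  then have "(\<lambda>k. proj (z (r k) - zs) \<bullet> P (proj (z (r k) - zs))) \<longlonglongrightarrow> 0 \<bullet> P 0"
    by (intro tendsto_inner bounded_linear.tendsto[OF bounded_linear_P])
  then have sub: "(?N \<circ> r) \<longlonglongrightarrow> 0" by (simp add: o_def flip: N)
  obtain L where L: "?N \<longlonglongrightarrow> L" using seminorm_convergent[OF zs(1)] by (auto simp: convergent_def)
  have "L = 0" using LIMSEQ_subseq_LIMSEQ[OF L r(1)] sub by (rule LIMSEQ_unique)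
  then show ?thesis using that[OF zs(1) P_tendsto_0] L by simp
qed

lemma proj_tendsto:
  assumes "(\<lambda>k. P (z k - zs)) \<longlonglongrightarrow> 0"
  shows "(\<lambda>k. proj (z k)) \<longlonglongrightarrow> proj zs" "(\<lambda>k. proj (zb k)) \<longlonglongrightarrow> proj zs"
proof -
  have "(\<lambda>k. proj (z k) - proj zs) \<longlonglongrightarrow> 0"
    using tendsto_proj_0[OF assms] linear_diff[OF bounded_linear.linear[OF bounded_linear_proj]] by simp
  then show 1: "(\<lambda>k. proj (z k)) \<longlonglongrightarrow> proj zs" by (simp add: LIM_zero_iff)
  show "(\<lambda>k. proj (zb k)) \<longlonglongrightarrow> proj zs"
    using tendsto_diff[OF 1 proj_diff_tendsto_0] by simp
qed

text \<open>The recursion reads \<open>z\<^bsub>k+1\<^esub> - l = (1 - \<lambda>\<^sub>k) (z\<^sub>k - l) + \<lambda>\<^sub>k (zb\<^sub>k - l)\<close>, and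
  \<open>\<bar>1 - \<lambda>\<^sub>k\<bar>\<close> stays away from 1.\<close>

lemma z_tendsto:
  assumes zb: "zb \<longlonglongrightarrow> l" and lam2: "uniformly_bounded_in lam 0 2"
  shows "z \<longlonglongrightarrow> l"
proof -
  obtain c d where cd: "0 < c" "c \<le> d" "d < 2" "\<And>k. c \<le> lam k" "\<And>k. lam k \<le> d"
    using lam2 by (auto simp: uniformly_bounded_in_def image_subset_iff)
  define \<rho> where "\<rho> = max (1 - c) (d - 1)"
  have \<rho>1: "\<rho> < 1" using cd by (simp add: \<rho>_def)
  have \<rho>: "\<bar>1 - lam k\<bar> \<le> \<rho>" for k using cd(4,5)[of k] by (auto simp: \<rho>_def)
  have \<rho>0: "0 \<le> \<rho>" using \<rho>[of 0] by linarith
  define a where "a = (\<lambda>k. norm (z k - l))"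
  define b where "b = (\<lambda>k. 2 * norm (zb k - l))"
  have b: "b \<longlonglongrightarrow> 0" unfolding b_def
    using tendsto_mult_right_zero[OF tendsto_norm_zero[OF LIM_zero[OF zb]]] .
  have rec: "a (Suc k) \<le> \<rho> * a k + b k" for k
  proof -
    have "z (Suc k) - l = (1 - lam k) *\<^sub>R (z k - l) + lam k *\<^sub>R (zb k - l)"
      by (simp add: step algebra_simps)
    then have "a (Suc k) \<le> \<bar>1 - lam k\<bar> * a k + \<bar>lam k\<bar> * norm (zb k - l)"
      unfolding a_def using norm_triangle_ineq by (metis norm_scaleR)
    also have "\<dots> \<le> \<rho> * a k + 2 * norm (zb k - l)"
      using \<rho>[of k] lam(1)[of k] cd(3) cd(5)[of k] unfolding a_def
      by (intro add_mono mult_right_mono) auto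
    finally show ?thesis by (simp add: b_def)
  qed
  have "a \<longlonglongrightarrow> 0"
  proof (rule LIMSEQ_I)
    fix e :: real assume e: "0 < e"
    \<comment> \<open>With this threshold for \<open>b\<close>, e / 2 is the fixed point of the map
      t -> \<rho> t + (1 - \<rho>) e / 2, so it reproduces itself in the induction below.\<close>
    have "0 < e / 2 * (1 - \<rho>)" using e \<rho>1 by simp
    from order_tendstoD(2)[OF b this]
    obtain K where K: "\<And>k. k \<ge> K \<Longrightarrow> b k < e / 2 * (1 - \<rho>)"
      by (auto simp: eventually_sequentially)
    have bnd: "a (K + j) \<le> \<rho> ^ j * a K + e / 2" for j
    proof (induction j)
      case 0
      then show ?case using e by simp
    next
      case (Suc j)
      have "a (K + Suc j) \<le> \<rho> * a (K + j) + b (K + j)" using rec[of "K + j"] by simp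
      also have "\<dots> \<le> \<rho> * (\<rho> ^ j * a K + e / 2) + e / 2 * (1 - \<rho>)"
        using mult_left_mono[OF Suc.IH \<rho>0] K[of "K + j"] by linarith
      finally show ?case by (simp add: field_simps)
    qed
    have "(\<lambda>j. \<rho> ^ j * a K) \<longlonglongrightarrow> 0"
      using \<rho>0 \<rho>1 by (intro tendsto_mult_left_zero LIMSEQ_power_zero) simp
    from order_tendstoD(2)[OF this, of "e / 2"] e
    obtain J where J: "\<And>j. j \<ge> J \<Longrightarrow> \<rho> ^ j * a K < e / 2"
      by (auto simp: eventually_sequentially)
    show "\<exists>no. \<forall>n\<ge>no. norm (a n - 0) < e"
    proof (intro exI allI impI)
      fix n assume n: "n \<ge> K + J"
      then have "J \<le> n - K" "K + (n - K) = n" by simp_all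
      then have "a n < e" using bnd[of "n - K"] J[of "n - K"] by simp
      then show "norm (a n - 0) < e" by (simp add: a_def)
    qed
  qed
  then show ?thesis unfolding a_def by (simp add: tendsto_norm_zero_iff LIM_zero_iff)
qed

end

subsection \<open>Singular values\<close>

text \<open>As a simp rule this would turn \<open>transpose L *v y\<close> into a vector-matrix
  product, whereas the definitions and the adjoint identity use the transpose.\<close>

declare transpose_matrix_vector [simp del]

section \<open>Adjoints, ranges and kernels\<close>

lemma inner_matrix_transpose:
  fixes L :: "real^'n^'m"
  shows "(L *v x) \<bullet> y = x \<bullet> (transpose L *v y)"
  by (metis dot_lmul_matrix inner_commute vector_transpose_matrix transpose_transpose)

lemma inner_gram_sym:
  fixes L :: "real^'n^'m"
  shows "(transpose L *v (L *v x)) \<bullet> y = x \<bullet> (transpose L *v (L *v y))"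
proof -
  have "(transpose L *v (L *v x)) \<bullet> y = (L *v y) \<bullet> (L *v x)"
    by (simp only: inner_matrix_transpose inner_commute[of y])
  then show ?thesis by (simp only: inner_matrix_transpose[symmetric] inner_commute)
qed

lemma rng_orthogonal_ker:
  fixes L :: "real^'n^'m"
  assumes "a \<in> rng (transpose L)" "b \<in> ker L"
  shows "a \<bullet> b = 0"
proof -
  obtain s where "a = transpose L *v s" using assms(1) by (auto simp: rng_def)
  then show ?thesis
    using assms(2) by (simp add: inner_matrix_transpose ker_def)
qed

lemma subspace_rng: "subspace (rng L)"
  unfolding rng_def by (rule subspace_range_linear) simp

lemma subspace_ker: "subspace (ker L)"
  unfolding ker_def by (rule linear_subspace_kernel) simp

lemma orth_proj_rng_ker:
  fixes L :: "real^'n^'m"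
  assumes "a \<in> rng (transpose L)" "b \<in> ker L"
  shows "orth_proj (rng (transpose L)) (a + b) = a" "orth_proj (ker L) (a + b) = b"
proof -
  have "b \<in> (rng (transpose L))\<^sup>\<bottom>"
    using assms(2) rng_orthogonal_ker by (auto simp: orthogonal_comp_def orthogonal_def)
  then show "orth_proj (rng (transpose L)) (a + b) = a"
    using assms(1) by (intro orth_proj_eqI subspace_rng) simp_all
  have "a \<in> (ker L)\<^sup>\<bottom>"
    using rng_orthogonal_ker[OF assms(1)] by (auto simp: orthogonal_comp_def orthogonal_def inner_commute)
  then show "orth_proj (ker L) (a + b) = b"
    using assms(2) by (intro orth_proj_eqI subspace_ker) simp_all
qed

text \<open>The remainder \<open>b\<close> is orthogonal to the range of the transpose, in
  particular to \<open>transpose L *v (L *v b)\<close>, and that inner product is |L b|^2.\<close>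

lemma rng_ker_decomposition:
  fixes L :: "real^'n^'m"
  obtains a b where "a \<in> rng (transpose L)" "b \<in> ker L" "x = a + b"
proof -
  let ?E = "rng (transpose L)"
  define a b where "a = orth_proj ?E x" and "b = x - orth_proj ?E x"
  have a: "a \<in> ?E" and b: "b \<in> ?E\<^sup>\<bottom>"
    unfolding a_def b_def by (rule orth_proj_decomp[OF subspace_rng])+
  have "(transpose L *v (L *v b)) \<bullet> b = 0"
    using b by (auto simp: orthogonal_comp_def orthogonal_def rng_def)
  then have "(L *v b) \<bullet> (L *v b) = 0" by (simp add: inner_matrix_transpose)
  then have "b \<in> ker L" by (simp add: ker_def)
  moreover have "x = a + b" by (simp add: a_def b_def)
  ultimately show ?thesis using a by (intro that)
qed

lemma ker_trivial:
  fixes L :: "real^'n^'m"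
  assumes "rank L = CARD('n)" "x \<in> ker L"
  shows "x = 0"
proof -
  have "inj ((*v) L)" using assms(1) by (simp add: full_rank_injective)
  moreover have "L *v x = L *v 0" using assms(2) by (simp add: ker_def)
  ultimately show ?thesis by (rule injD)
qed

section \<open>Singular values and the operator norm\<close>

lemma singular_value_norm:
  fixes L :: "real^'n^'m"
  assumes "transpose L *v (L *v v) = \<sigma>\<^sup>2 *\<^sub>R v"
  shows "(norm (L *v v))\<^sup>2 = \<sigma>\<^sup>2 * (norm v)\<^sup>2"
  by (simp only: power2_norm_eq_inner inner_matrix_transpose assms inner_scaleR_right)

lemma pos_singular_value_le_opnorm:
  assumes "\<sigma> \<in> pos_singular_values L"
  shows "0 < \<sigma>" "\<sigma> \<le> opnorm L"
proof -
  obtain v where v: "v \<noteq> 0" "transpose L *v (L *v v) = \<sigma>\<^sup>2 *\<^sub>R v" and \<sigma>: "0 < \<sigma>"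
    using assms by (auto simp: pos_singular_values_def)
  have "(norm (L *v v))\<^sup>2 = (\<sigma> * norm v)\<^sup>2"
    using singular_value_norm[OF v(2)] by (simp add: power_mult_distrib)
  then have "norm (L *v v) = \<sigma> * norm v"
    using \<sigma> by (simp add: power2_eq_iff_nonneg)
  then have "\<sigma> * norm v \<le> opnorm L * norm v"
    using onorm[OF matrix_vector_mul_bounded_linear, of L v] by simp
  then show "\<sigma> \<le> opnorm L" using v(1) by simp
  show "0 < \<sigma>" by (rule \<sigma>)
qed

text \<open>A right singular basis; the vectors with \<open>s b = 0\<close> span the kernel.\<close>

lemma singular_basis:
  fixes L :: "real^'n^'m"
  obtains B and s :: "real^'n \<Rightarrow> real" where
    "finite B" "\<And>b. b \<in> B \<Longrightarrow> s b = 0 \<or> s b \<in> pos_singular_values L"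
    "\<And>b. b \<in> B \<Longrightarrow> transpose L *v (L *v b) = (s b)\<^sup>2 *\<^sub>R b"
    "\<And>x y. x \<bullet> y = (\<Sum>b\<in>B. (x \<bullet> b) * (y \<bullet> b))"
proof -
  let ?M = "\<lambda>x. transpose L *v (L *v x)"
  have "linear ?M" 
    using matrix_vector_mul_linear[of "transpose L ** L"] by (simp add: matrix_vector_mul_assoc)
  moreover have sym: "?M x \<bullet> y = x \<bullet> ?M y" for x y
    by (rule inner_gram_sym)
  ultimately obtain B where B: "finite B" "\<And>b. b \<in> B \<Longrightarrow> norm b = 1"
      "\<And>b. b \<in> B \<Longrightarrow> \<exists>c. ?M b = c *\<^sub>R b" "\<And>x y. x \<bullet> y = (\<Sum>b\<in>B. (x \<bullet> b) * (y \<bullet> b))"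
    using self_adjoint_orthonormal_eigenbasis[of ?M] by blast
  define s where "s b = norm (L *v b)" for b
  have ev: "?M b = (s b)\<^sup>2 *\<^sub>R b" if b: "b \<in> B" for b
  proof -
    obtain c where c: "?M b = c *\<^sub>R b" using B(3)[OF b] by blast
    have "(s b)\<^sup>2 = b \<bullet> ?M b" by (simp add: s_def power2_norm_eq_inner inner_matrix_transpose)
    also have "\<dots> = c" using B(2)[OF b] by (simp add: c dot_square_norm)
    finally show ?thesis using c by simp
  qed
  have "s b = 0 \<or> s b \<in> pos_singular_values L" if "b \<in> B" for b
  proof (cases "s b = 0")
    case False
    then have "s b > 0" by (simp add: s_def)
    moreover have "b \<noteq> 0" using B(2)[OF that] by auto
    ultimately show ?thesis using ev[OF that] by (auto simp: pos_singular_values_def)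
  qed simp
  then show ?thesis using that[of B s] B ev by blast
qed

lemma opnorm_pos: "L \<noteq> 0 \<Longrightarrow> 0 < opnorm (L::real^'n^'m)"
  using onorm_pos_lt[OF matrix_vector_mul_bounded_linear, of L] by (simp add: matrix_eq)

text \<open>Parseval in the singular basis bounds |L x| by m |x|, where \<open>m\<close> is the
  largest value of \<open>s\<close>. So the operator norm is at most \<open>m\<close>; being
  positive, \<open>m\<close> is a singular value and thus at most the operator norm.\<close>

lemma opnorm_singular_value:
  fixes L :: "real^'n^'m"
  assumes "L \<noteq> 0"
  shows "opnorm L \<in> pos_singular_values L"
proof -
  obtain B and s :: "real^'n \<Rightarrow> real" where B: "finite B"
    "\<And>b. b \<in> B \<Longrightarrow> s b = 0 \<or> s b \<in> pos_singular_values L"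
    "\<And>b. b \<in> B \<Longrightarrow> transpose L *v (L *v b) = (s b)\<^sup>2 *\<^sub>R b"
    "\<And>x y. x \<bullet> y = (\<Sum>b\<in>B. (x \<bullet> b) * (y \<bullet> b))"
    by (rule singular_basis[of L]) (rule that)
  \<comment> \<open>The inserted 0 keeps the set nonempty and yields \<open>0 \<le> m\<close>; that
    \<open>m\<close> is not this 0 follows below from \<open>L \<noteq> 0\<close>.\<close>
  define m where "m = Max (insert 0 (s ` B))"
  have m: "0 \<le> m" "\<And>b. b \<in> B \<Longrightarrow> s b \<le> m" using B(1) by (auto simp: m_def)
  have "norm (L *v x) \<le> m * norm x" for x
  proof -
    have "(norm (L *v x))\<^sup>2 = x \<bullet> (transpose L *v (L *v x))"
      by (simp add: power2_norm_eq_inner inner_matrix_transpose)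
    also have "\<dots> = (\<Sum>b\<in>B. (x \<bullet> b) * ((transpose L *v (L *v x)) \<bullet> b))" by (rule B(4))
    also have "\<dots> = (\<Sum>b\<in>B. (s b)\<^sup>2 * (x \<bullet> b)\<^sup>2)"
    proof (rule sum.cong[OF refl])
      fix b assume "b \<in> B"
      show "(x \<bullet> b) * ((transpose L *v (L *v x)) \<bullet> b) = (s b)\<^sup>2 * (x \<bullet> b)\<^sup>2"
        using B(3)[OF \<open>b \<in> B\<close>] by (simp add: inner_gram_sym[of L x b] power2_eq_square)
    qed
    also have "\<dots> \<le> (\<Sum>b\<in>B. m\<^sup>2 * (x \<bullet> b)\<^sup>2)"
    proof (intro sum_mono mult_right_mono zero_le_power2 power_mono m(2))
      fix b assume "b \<in> B"
      then show "0 \<le> s b" using B(2)[of b] pos_singular_value_le_opnorm(1)[of "s b" L] by fastforce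
    qed
    also have "\<dots> = m\<^sup>2 * (x \<bullet> x)"
      by (subst B(4)) (simp add: sum_distrib_left power2_eq_square)
    also have "\<dots> = (m * norm x)\<^sup>2"
      by (simp add: power_mult_distrib power2_norm_eq_inner)
    finally show ?thesis by (rule power2_le_imp_le) (simp add: m(1))
  qed
  then have le: "opnorm L \<le> m" by (intro onorm_le)
  then have pos: "m > 0" using opnorm_pos[OF assms] by linarith
  have "m \<in> insert 0 (s ` B)" unfolding m_def using B(1) by (intro Max_in) auto
  then obtain b where "b \<in> B" "m = s b" using pos by blast
  then have mem: "m \<in> pos_singular_values L" using B(2)[of b] pos by simp
  then have "m = opnorm L" using le pos_singular_value_le_opnorm(2)[OF mem] by linarith
  with mem show ?thesis by simp
qed

text \<open>\<open>sv\<close> counts from 1 in the descending list, so position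
  \<open>num_sv L\<close> is the head of the ascending one. The hypothesis guarantees that this head
  exists.\<close>

lemma sv_num_sv:
  assumes "\<sigma> \<in> pos_singular_values L"
  shows "sv L (num_sv L) \<in> pos_singular_values L" "sv L (num_sv L) \<le> \<sigma>"
proof -
  let ?S = "pos_singular_values L" and ?xs = "sorted_list_of_set (pos_singular_values L)"
  note fin = finite_pos_singular_values[of L]
  have len: "length ?xs = num_sv L" by (simp add: num_sv_def)
  have pos: "0 < num_sv L" using assms fin by (auto simp: num_sv_def card_gt_0_iff)
  have eq: "sv L (num_sv L) = ?xs ! 0"
    using pos len by (simp add: sv_def rev_nth)
  then show "sv L (num_sv L) \<in> ?S"
    using pos len fin nth_mem[of 0 ?xs] by simp
  obtain i where "i < length ?xs" "\<sigma> = ?xs ! i"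
    using assms fin by (metis in_set_conv_nth set_sorted_list_of_set)
  then show "sv L (num_sv L) \<le> \<sigma>"
    unfolding eq by (simp add: sorted_nth_mono)
qed

text \<open>The operator norm heads the descending list, so any other entry has list index at least
  1, the index that \<open>sv L 2\<close> reads.\<close>

lemma le_sv_2:
  assumes "L \<noteq> 0" "\<sigma> \<in> pos_singular_values L" "\<sigma> \<noteq> opnorm L"
  shows "\<sigma> \<le> sv L 2"
proof -
  let ?S = "pos_singular_values L" and ?xs = "rev (sorted_list_of_set (pos_singular_values L))"
  note fin = finite_pos_singular_values[of L]
  have set: "set ?xs = ?S" using fin by simp
  have desc: "?xs ! j \<le> ?xs ! i" if "i \<le> j" "j < length ?xs" for i j
    using that by (intro sorted_rev_nth_mono) simp_all
  obtain i where i: "i < length ?xs" "\<sigma> = ?xs ! i"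
    using assms(2) set by (metis in_set_conv_nth)
  obtain j where j: "j < length ?xs" "opnorm L = ?xs ! j"
    using opnorm_singular_value[OF assms(1)] set by (metis in_set_conv_nth)
  have "i \<noteq> 0"
  proof
    assume "i = 0"
    then have "opnorm L \<le> \<sigma>" using desc[of 0 j] i j by simp
    then show False using pos_singular_value_le_opnorm(2)[OF assms(2)] assms(3) by simp
  qed
  then have "1 \<le> i" by simp
  then show ?thesis using desc[of 1 i] i by (simp add: sv_def)
qed

section \<open>Binary quadratic forms\<close>

lemma quadratic_form_nonneg:
  fixes a b c :: real
  assumes "0 \<le> a" "0 \<le> c" "b\<^sup>2 \<le> a * c"
  shows "0 \<le> a * X\<^sup>2 - 2 * b * X * Y + c * Y\<^sup>2"
proof (cases "a = 0")
  case True
  then show ?thesis using assms by simp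
next
  case False
  have "a * (a * X\<^sup>2 - 2 * b * X * Y + c * Y\<^sup>2) = (a * X - b * Y)\<^sup>2 + (a * c - b\<^sup>2) * Y\<^sup>2"
    by (simp add: power2_eq_square algebra_simps)
  also have "\<dots> \<ge> 0" using assms by simp
  finally show ?thesis using False assms(1) by (simp add: zero_le_mult_iff)
qed

text \<open>The form restricted to a pair of singular vectors, with \<open>r\<^sup>2 = \<gamma> \<tau> \<sigma>\<^sup>2\<close>. Its determinant is
  \<open>(1 - r\<^sup>2) (((p + q) / 2 - \<eta>)\<^sup>2 - R)\<close>, where \<open>R\<close> is the radicand below.\<close>

lemma singular_block_nonneg:
  fixes p q r \<eta> :: real
  assumes "r\<^sup>2 < 1 \<and> \<eta> \<le> (p + q) / 2 - sqrt (((p - q) / 2)\<^sup>2 + p * q * r\<^sup>2) \<or>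
    r\<^sup>2 = 1 \<and> \<eta> \<le> p + q"
  shows "0 \<le> (p + q * r\<^sup>2 - \<eta>) * X\<^sup>2 - 2 * ((p + q - \<eta>) * r) * X * Y + (q + p * r\<^sup>2 - \<eta>) * Y\<^sup>2"
  using assms
proof (elim disjE conjE)
  assume s: "r\<^sup>2 < 1" and \<eta>: "\<eta> \<le> (p + q) / 2 - sqrt (((p - q) / 2)\<^sup>2 + p * q * r\<^sup>2)"
  define R where "R = ((p - q) / 2)\<^sup>2 + p * q * r\<^sup>2"
  have d: "sqrt R \<le> (p + q) / 2 - \<eta>" using \<eta> by (simp add: R_def)
  \<comment> \<open>A convex combination of squares, hence nonnegative even if p q is
    negative.\<close>
  have "R = r\<^sup>2 * ((p + q) / 2)\<^sup>2 + (1 - r\<^sup>2) * ((p - q) / 2)\<^sup>2"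
    by (simp add: R_def power2_eq_square field_simps)
  then have R0: "0 \<le> R" using s by simp
  have sq: "R \<le> ((p + q) / 2 - \<eta>)\<^sup>2"
    using d R0 by (metis real_sqrt_ge_zero real_sqrt_pow2 power_mono)
  \<comment> \<open>Each diagonal entry is (p + q) / 2 - \<eta> plus such a term, with (a, b) = (p,
    q) or (q, p); \<open>R\<close> is symmetric in p and q, so one bound serves both.\<close>
  have diag: "\<bar>(a - b) / 2 + b * r\<^sup>2\<bar> \<le> sqrt R" if "((a - b) / 2)\<^sup>2 + a * b * r\<^sup>2 = R" for a b
  proof (rule real_le_rsqrt)
    have "R - ((a - b) / 2 + b * r\<^sup>2)\<^sup>2 = b\<^sup>2 * r\<^sup>2 * (1 - r\<^sup>2)"
      unfolding that[symmetric] by (simp add: power2_eq_square field_simps)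
    also have "\<dots> \<ge> 0" using s by simp
    finally show "\<bar>(a - b) / 2 + b * r\<^sup>2\<bar>\<^sup>2 \<le> R" by simp
  qed
  show ?thesis
  proof (rule quadratic_form_nonneg)
    show "0 \<le> p + q * r\<^sup>2 - \<eta>" using diag[of p q] d by (simp add: R_def field_simps abs_le_iff)
    show "0 \<le> q + p * r\<^sup>2 - \<eta>"
    proof -
      have "((q - p) / 2)\<^sup>2 + q * p * r\<^sup>2 = R"
        by (simp add: R_def power2_eq_square field_simps)
      from diag[OF this] d show ?thesis by (simp add: field_simps abs_le_iff)
    qed
    have "(p + q * r\<^sup>2 - \<eta>) * (q + p * r\<^sup>2 - \<eta>) - ((p + q - \<eta>) * r)\<^sup>2 =
        (1 - r\<^sup>2) * (((p + q) / 2 - \<eta>)\<^sup>2 - R)"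
      by (simp add: R_def power2_eq_square field_simps)
    also have "\<dots> \<ge> 0" using s sq by simp
    finally show "((p + q - \<eta>) * r)\<^sup>2 \<le> (p + q * r\<^sup>2 - \<eta>) * (q + p * r\<^sup>2 - \<eta>)" by simp
  qed
next
  assume "r\<^sup>2 = 1" "\<eta> \<le> p + q"
  \<comment> \<open>Here the form equals (p + q - \<eta>) (X - r Y)^2.\<close>
  then show ?thesis
    by (intro quadratic_form_nonneg) (auto simp: power_mult_distrib power2_eq_square algebra_simps)
qed

subsection \<open>The oblique inequality \<open>P V P \<ge> \<eta> P\<close>\<close>

lemma Delta_eq: "Delta \<beta>P \<beta>D \<gamma> \<tau> = (\<beta>P / \<gamma> + \<beta>D / \<tau>) / 2"
  by (simp add: Delta_def field_simps)

text \<open>Shows theta as a perturbation of |Delta|: for \<gamma> \<tau> \<sigma>^2 \<le> 1 the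
  sign of the product of \<beta>P and \<beta>D decides which of the two is larger.\<close>

lemma theta_radicand:
  assumes "\<gamma> > 0" "\<tau> > 0"
  shows "(1 / (2 * \<gamma>) * \<beta>P - 1 / (2 * \<tau>) * \<beta>D)\<^sup>2 + \<beta>P * \<beta>D * \<sigma>\<^sup>2 =
    (Delta \<beta>P \<beta>D \<gamma> \<tau>)\<^sup>2 - \<beta>P * \<beta>D * (1 - \<gamma> * \<tau> * \<sigma>\<^sup>2) / (\<gamma> * \<tau>)"
  using assms by (simp add: Delta_def power2_eq_square field_simps)

lemma theta_mono:
  assumes "0 \<le> \<beta>P * \<beta>D" "0 \<le> \<sigma>" "\<sigma> \<le> \<sigma>'"
  shows "theta \<beta>P \<beta>D \<gamma> \<tau> \<sigma> \<le> theta \<beta>P \<beta>D \<gamma> \<tau> \<sigma>'"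
  unfolding theta_def using assms
  by (intro real_sqrt_le_mono add_left_mono mult_left_mono power_mono)

lemma theta_antimono:
  assumes "\<beta>P * \<beta>D \<le> 0" "0 \<le> \<sigma>" "\<sigma> \<le> \<sigma>'"
  shows "theta \<beta>P \<beta>D \<gamma> \<tau> \<sigma>' \<le> theta \<beta>P \<beta>D \<gamma> \<tau> \<sigma>"
  unfolding theta_def using assms
  by (intro real_sqrt_le_mono add_left_mono mult_left_mono_neg power_mono)

lemma Delta_theta_compare:
  assumes "\<gamma> > 0" "\<tau> > 0" "\<gamma> * \<tau> * \<sigma>\<^sup>2 \<le> 1"
  shows "\<beta>P * \<beta>D \<le> 0 \<Longrightarrow> \<bar>Delta \<beta>P \<beta>D \<gamma> \<tau>\<bar> \<le> theta \<beta>P \<beta>D \<gamma> \<tau> \<sigma>"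
    and "0 \<le> \<beta>P * \<beta>D \<Longrightarrow> theta \<beta>P \<beta>D \<gamma> \<tau> \<sigma> \<le> \<bar>Delta \<beta>P \<beta>D \<gamma> \<tau>\<bar>"
proof -
  let ?e = "\<beta>P * \<beta>D * (1 - \<gamma> * \<tau> * \<sigma>\<^sup>2) / (\<gamma> * \<tau>)"
  note rad = theta_radicand[OF assms(1,2)]
  {
    assume "\<beta>P * \<beta>D \<le> 0"
    then have "\<beta>P * \<beta>D * (1 - \<gamma> * \<tau> * \<sigma>\<^sup>2) \<le> 0"
      using assms(3) by (rule mult_nonpos_nonneg[OF _ iffD2[OF diff_ge_0_iff_ge]])
    then have "?e \<le> 0" using assms(1,2) by (intro divide_nonpos_pos) auto
    then show "\<bar>Delta \<beta>P \<beta>D \<gamma> \<tau>\<bar> \<le> theta \<beta>P \<beta>D \<gamma> \<tau> \<sigma>"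
      unfolding theta_def rad by (intro real_le_rsqrt) simp
  next
    assume "0 \<le> \<beta>P * \<beta>D"
    then have "0 \<le> \<beta>P * \<beta>D * (1 - \<gamma> * \<tau> * \<sigma>\<^sup>2)"
      using assms(3) by (rule mult_nonneg_nonneg[OF _ iffD2[OF diff_ge_0_iff_ge]])
    then have "0 \<le> ?e" using assms(1,2) by (intro divide_nonneg_pos) auto
    then show "theta \<beta>P \<beta>D \<gamma> \<tau> \<sigma> \<le> \<bar>Delta \<beta>P \<beta>D \<gamma> \<tau>\<bar>"
      unfolding theta_def rad by (intro real_le_lsqrt) simp_all
  }
qed

lemma stepsize_rule_le:
  assumes "stepsize_rule L \<beta>P \<beta>D \<gamma> \<tau>" "L \<noteq> 0" "\<gamma> > 0"
  shows "\<gamma> * \<tau> * (opnorm (L::real^'n^'m))\<^sup>2 \<le> 1"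
proof -
  have "\<tau> \<le> 1 / (\<gamma> * (opnorm L)\<^sup>2)"
    using assms(1) unfolding stepsize_rule_def by (cases "0 \<le> \<beta>P"; cases "0 \<le> \<beta>D") auto
  moreover have "0 < \<gamma> * (opnorm L)\<^sup>2" using opnorm_pos[OF assms(2)] assms(3) by simp
  ultimately show ?thesis by (simp add: field_simps)
qed

text \<open>\<open>eta\<close> is chosen as the worst block bound. For \<beta>P \<beta>D < 0, theta
  decreases in \<sigma>, so the smallest singular value decides, and theta \<ge> |Delta| covers the
  degenerate block too. Otherwise theta increases, and among nondegenerate blocks the largest
  singular value decides. The bound 2 Delta of a degenerate top block is the weaker one if both
  parameters are nonnegative, since then Delta \<ge> 0, and the stronger one if both are
  nonpositive, since then theta \<le> |Delta| = - Delta.\<close>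

lemma eta_le:
  fixes L :: "real^'n^'m" and \<beta>P \<beta>D \<gamma> \<tau> :: real
  assumes L: "L \<noteq> 0" and pos: "\<gamma> > 0" "\<tau> > 0" and le: "\<gamma> * \<tau> * (opnorm L)\<^sup>2 \<le> 1"
    and \<sigma>: "\<sigma> \<in> pos_singular_values L"
  defines "D \<equiv> Delta \<beta>P \<beta>D \<gamma> \<tau>" and "\<theta> \<equiv> theta \<beta>P \<beta>D \<gamma> \<tau>"
  shows "\<gamma> * \<tau> * \<sigma>\<^sup>2 < 1 \<and> eta L \<beta>P \<beta>D \<gamma> \<tau> \<le> D - \<theta> \<sigma> \<or>
    \<gamma> * \<tau> * \<sigma>\<^sup>2 = 1 \<and> eta L \<beta>P \<beta>D \<gamma> \<tau> \<le> 2 * D"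
proof -
  let ?S = "pos_singular_values L" and ?\<eta> = "eta L \<beta>P \<beta>D \<gamma> \<tau>" and ?m = "sv L (num_sv L)"
  have op: "0 < opnorm L" by (rule opnorm_pos[OF L])
  have S: "0 \<le> s" "s \<le> opnorm L" if "s \<in> ?S" for s
    using pos_singular_value_le_opnorm[OF that] by simp_all
  have s1: "\<gamma> * \<tau> * s\<^sup>2 \<le> 1" if "s \<in> ?S" for s
  proof -
    have "\<gamma> * \<tau> * s\<^sup>2 \<le> \<gamma> * \<tau> * (opnorm L)\<^sup>2"
      using S[OF that] pos by (intro mult_left_mono power_mono) auto
    then show ?thesis using le by simp
  qed
  have m: "?m \<in> ?S" "?m \<le> \<sigma>" using sv_num_sv[OF \<sigma>] by auto
  have neg: "D - \<theta> ?m \<le> D - \<theta> \<sigma>" "D - \<theta> ?m \<le> 2 * D" if "\<beta>P * \<beta>D < 0"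
    using that theta_antimono[OF _ S(1)[OF m(1)] m(2), of \<beta>P \<beta>D \<gamma> \<tau>]
      Delta_theta_compare(1)[OF pos s1[OF m(1)], of \<beta>P \<beta>D] by (auto simp: D_def \<theta>_def)
  have mono: "D - \<theta> s \<le> D - \<theta> \<sigma>" if "0 \<le> \<beta>P * \<beta>D" "\<sigma> \<le> s" for s
    using theta_mono[OF that(1) S(1)[OF \<sigma>] that(2)] by (simp add: \<theta>_def)
  have op2: "0 < (opnorm L)\<^sup>2" using op by simp
  show ?thesis
  proof (cases "\<gamma> * \<tau> < 1 / (opnorm L)\<^sup>2")
    case True
    have "\<gamma> * \<tau> * \<sigma>\<^sup>2 \<le> \<gamma> * \<tau> * (opnorm L)\<^sup>2"
      using S[OF \<sigma>] pos by (intro mult_left_mono power_mono) auto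
    also have "\<dots> < 1" using True op2 by (simp add: field_simps)
    finally have "\<gamma> * \<tau> * \<sigma>\<^sup>2 < 1" .
    moreover have "?\<eta> \<le> D - \<theta> \<sigma>"
      using True neg mono[OF _ S(2)[OF \<sigma>]] by (auto simp: eta_def D_def \<theta>_def)
    ultimately show ?thesis by blast
  next
    case False
    then have eq: "\<gamma> * \<tau> * (opnorm L)\<^sup>2 = 1"
      using le op2 by (simp add: field_simps)
    have nn: "0 \<le> D" "0 \<le> \<beta>P * \<beta>D" if "min \<beta>P \<beta>D \<ge> 0"
      using that pos by (auto simp: D_def Delta_def)
    have np: "D \<le> 0" if "\<not> min \<beta>P \<beta>D \<ge> 0" "\<not> \<beta>P * \<beta>D < 0"
    proof -
      have "\<beta>P \<le> 0" "\<beta>D \<le> 0" using that by (auto simp: min_def not_less zero_le_mult_iff split: if_splits)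
      then show ?thesis using pos by (simp add: D_def Delta_eq divide_nonpos_pos add_nonpos_nonpos)
    qed
    show ?thesis
    proof (cases "\<sigma> = opnorm L")
      case True
      have "0 \<le> \<theta> (sv L 2)" if "min \<beta>P \<beta>D \<ge> 0"
        using nn[OF that] by (simp add: \<theta>_def theta_def)
      then have "?\<eta> \<le> 2 * D"
        using False neg nn by (auto simp: eta_def D_def \<theta>_def)
      then show ?thesis using True eq by simp
    next
      case ne: False
      then have lt: "\<sigma> < opnorm L" using S(2)[OF \<sigma>] by simp
      have "\<gamma> * \<tau> * \<sigma>\<^sup>2 < \<gamma> * \<tau> * (opnorm L)\<^sup>2"
        using lt S(1)[OF \<sigma>] pos by (intro mult_strict_left_mono power_strict_mono) auto
      then have s: "\<gamma> * \<tau> * \<sigma>\<^sup>2 < 1" using eq by simp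
      have "num_sv L \<noteq> 1"
      proof
        assume "num_sv L = 1"
        then obtain t where "?S = {t}" unfolding num_sv_def by (rule card_1_singletonE)
        then show False using ne \<sigma> opnorm_singular_value[OF L] by auto
      qed
      moreover have "D - \<theta> (sv L 2) \<le> D - \<theta> \<sigma>" if "min \<beta>P \<beta>D \<ge> 0"
        using mono[OF nn(2)[OF that] le_sv_2[OF L \<sigma> ne]] .
      moreover have "2 * D \<le> D - \<theta> \<sigma>" if "\<not> min \<beta>P \<beta>D \<ge> 0" "\<not> \<beta>P * \<beta>D < 0"
        using np[OF that] Delta_theta_compare(2)[OF pos s1[OF \<sigma>], of \<beta>P \<beta>D] that
        by (simp add: D_def \<theta>_def)
      ultimately have "?\<eta> \<le> D - \<theta> \<sigma>"
        using False neg by (auto simp: eta_def D_def \<theta>_def)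
      then show ?thesis using s by simp
    qed
  qed
qed

text \<open>Scaling the coordinates by sqrt \<gamma> and sqrt \<tau> reduces this to the normalized
  block; \<open>a\<close> and \<open>t\<close> stand for coordinates along a right singular vector
  and its left partner.\<close>

lemma singular_pair_form_nonneg:
  assumes pos: "\<gamma> > 0" "\<tau> > 0" and \<sigma>: "0 \<le> \<sigma>"
    and \<eta>: "\<gamma> * \<tau> * \<sigma>\<^sup>2 < 1 \<and> \<eta> \<le> Delta \<beta>P \<beta>D \<gamma> \<tau> - theta \<beta>P \<beta>D \<gamma> \<tau> \<sigma> \<or>
      \<gamma> * \<tau> * \<sigma>\<^sup>2 = 1 \<and> \<eta> \<le> 2 * Delta \<beta>P \<beta>D \<gamma> \<tau>"
  shows "0 \<le> (\<beta>P / \<gamma>\<^sup>2 - \<eta> / \<gamma> + \<beta>D * \<sigma>\<^sup>2) * a\<^sup>2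
    - 2 * (\<beta>P / \<gamma> + \<beta>D / \<tau> - \<eta>) * \<sigma> * a * t + (\<beta>D / \<tau>\<^sup>2 - \<eta> / \<tau> + \<beta>P * \<sigma>\<^sup>2) * t\<^sup>2"
proof -
  define p q r where "p = \<beta>P / \<gamma>" and "q = \<beta>D / \<tau>" and "r = sqrt (\<gamma> * \<tau>) * \<sigma>"
  have r2: "r\<^sup>2 = \<gamma> * \<tau> * \<sigma>\<^sup>2" using pos by (simp add: r_def power_mult_distrib)
  have th: "theta \<beta>P \<beta>D \<gamma> \<tau> \<sigma> = sqrt (((p - q) / 2)\<^sup>2 + p * q * r\<^sup>2)"
    unfolding theta_def r2 p_def q_def using pos by (simp add: field_simps)
  have D: "Delta \<beta>P \<beta>D \<gamma> \<tau> = (p + q) / 2" by (simp add: Delta_eq p_def q_def)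
  have "r\<^sup>2 < 1 \<and> \<eta> \<le> (p + q) / 2 - sqrt (((p - q) / 2)\<^sup>2 + p * q * r\<^sup>2) \<or>
      r\<^sup>2 = 1 \<and> \<eta> \<le> p + q"
    using \<eta> unfolding th D r2[symmetric] by auto
  from singular_block_nonneg[OF this, of "a / sqrt \<gamma>" "t / sqrt \<tau>"]
  have "0 \<le> (p + q * r\<^sup>2 - \<eta>) * (a / sqrt \<gamma>)\<^sup>2
    - 2 * ((p + q - \<eta>) * r) * (a / sqrt \<gamma>) * (t / sqrt \<tau>) + (q + p * r\<^sup>2 - \<eta>) * (t / sqrt \<tau>)\<^sup>2" .
  moreover have "(p + q * r\<^sup>2 - \<eta>) * (a / sqrt \<gamma>)\<^sup>2 = (\<beta>P / \<gamma>\<^sup>2 - \<eta> / \<gamma> + \<beta>D * \<sigma>\<^sup>2) * a\<^sup>2"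
    unfolding r2 p_def q_def using pos by (simp add: power_divide power2_eq_square field_simps)
  moreover have "(q + p * r\<^sup>2 - \<eta>) * (t / sqrt \<tau>)\<^sup>2 = (\<beta>D / \<tau>\<^sup>2 - \<eta> / \<tau> + \<beta>P * \<sigma>\<^sup>2) * t\<^sup>2"
    unfolding r2 p_def q_def using pos by (simp add: power_divide power2_eq_square field_simps)
  moreover have "2 * ((p + q - \<eta>) * r) * (a / sqrt \<gamma>) * (t / sqrt \<tau>) =
      2 * (\<beta>P / \<gamma> + \<beta>D / \<tau> - \<eta>) * \<sigma> * a * t"
    unfolding r_def p_def q_def using pos by (simp add: real_sqrt_mult)
  ultimately show ?thesis by simp
qed

text \<open>On \<open>rng (transpose L) \<times> rng L\<close>, writing \<open>y = L t\<close> and expanding \<open>a\<close> and \<open>t\<close> in right singular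
  vectors splits the form into its singular blocks.\<close>

lemma range_form_nonneg:
  fixes L :: "real^'n^'m" and \<beta>P \<beta>D \<gamma> \<tau> :: real
  assumes L: "L \<noteq> 0" and pos: "\<gamma> > 0" "\<tau> > 0" and le: "\<gamma> * \<tau> * (opnorm L)\<^sup>2 \<le> 1"
    and a: "a \<in> rng (transpose L)" and y: "y \<in> rng L"
  defines "\<eta> \<equiv> eta L \<beta>P \<beta>D \<gamma> \<tau>"
  shows "\<eta> * ((a \<bullet> a) / \<gamma> + (y \<bullet> y) / \<tau> - 2 * ((L *v a) \<bullet> y)) \<le>
    \<beta>P * (norm ((1 / \<gamma>) *\<^sub>R a - transpose L *v y))\<^sup>2 + \<beta>D * (norm ((1 / \<tau>) *\<^sub>R y - L *v a))\<^sup>2"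
proof -
  obtain t where t: "y = L *v t" using y by (auto simp: rng_def)
  obtain u where u: "a = transpose L *v u" using a by (auto simp: rng_def)
  obtain B and s :: "real^'n \<Rightarrow> real" where B: "finite B"
    "\<And>b. b \<in> B \<Longrightarrow> s b = 0 \<or> s b \<in> pos_singular_values L"
    "\<And>b. b \<in> B \<Longrightarrow> transpose L *v (L *v b) = (s b)\<^sup>2 *\<^sub>R b"
    "\<And>x y. x \<bullet> y = (\<Sum>b\<in>B. (x \<bullet> b) * (y \<bullet> b))"
    by (rule singular_basis[of L]) (rule that)
  let ?M = "\<lambda>x. transpose L *v (L *v x)"
  have Mb: "?M x \<bullet> b = (s b)\<^sup>2 * (x \<bullet> b)" if "b \<in> B" for x b
    by (simp add: inner_gram_sym[of L x b] B(3)[OF that])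
  have M1: "?M x \<bullet> x' = (\<Sum>b\<in>B. (s b)\<^sup>2 * (x \<bullet> b) * (x' \<bullet> b))" for x x'
    by (subst B(4), rule sum.cong) (simp_all add: Mb)
  have aa: "a \<bullet> a = (\<Sum>b\<in>B. (a \<bullet> b)\<^sup>2)"
    by (subst B(4)) (simp add: power2_eq_square)
  have yy: "y \<bullet> y = (\<Sum>b\<in>B. (s b)\<^sup>2 * (t \<bullet> b)\<^sup>2)"
    unfolding t inner_matrix_transpose
    by (subst inner_commute, subst M1) (simp add: power2_eq_square algebra_simps)
  have LaLa: "(L *v a) \<bullet> (L *v a) = (\<Sum>b\<in>B. (s b)\<^sup>2 * (a \<bullet> b)\<^sup>2)"
    unfolding inner_matrix_transpose
    by (subst inner_commute, subst M1) (simp add: power2_eq_square algebra_simps)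
  have Lay: "(L *v a) \<bullet> y = (\<Sum>b\<in>B. (s b)\<^sup>2 * (a \<bullet> b) * (t \<bullet> b))"
    unfolding t inner_matrix_transpose by (subst inner_commute, subst M1) (simp add: algebra_simps)
  have LyLy: "(transpose L *v y) \<bullet> (transpose L *v y) = (\<Sum>b\<in>B. (s b)\<^sup>2 * (s b)\<^sup>2 * (t \<bullet> b)\<^sup>2)"
    unfolding t by (subst M1, rule sum.cong) (simp_all add: Mb power2_eq_square)
  have aLy: "a \<bullet> (transpose L *v y) = (L *v a) \<bullet> y" by (simp add: inner_matrix_transpose)
  have n1: "(norm ((1 / \<gamma>) *\<^sub>R a - transpose L *v y))\<^sup>2 =
      (a \<bullet> a) / \<gamma>\<^sup>2 - 2 / \<gamma> * ((L *v a) \<bullet> y) + (transpose L *v y) \<bullet> (transpose L *v y)"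
    unfolding power2_norm_eq_inner using aLy pos
    by (simp add: inner_diff inner_commute[of "transpose L *v y" a] power2_eq_square field_simps)
  have n2: "(norm ((1 / \<tau>) *\<^sub>R y - L *v a))\<^sup>2 =
      (y \<bullet> y) / \<tau>\<^sup>2 - 2 / \<tau> * ((L *v a) \<bullet> y) + (L *v a) \<bullet> (L *v a)"
    unfolding power2_norm_eq_inner using pos
    by (simp add: inner_diff inner_commute[of y "L *v a"] power2_eq_square field_simps)
  \<comment> \<open>For \<open>s b \<noteq> 0\<close>, \<open>s b * (t \<bullet> b)\<close> is the
    inner product of \<open>y\<close> with the left singular vector L b / s b.\<close>
  let ?q = "\<lambda>b. (\<beta>P / \<gamma>\<^sup>2 - \<eta> / \<gamma> + \<beta>D * (s b)\<^sup>2) * (a \<bullet> b)\<^sup>2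
    - 2 * (\<beta>P / \<gamma> + \<beta>D / \<tau> - \<eta>) * s b * (a \<bullet> b) * (s b * (t \<bullet> b))
    + (\<beta>D / \<tau>\<^sup>2 - \<eta> / \<tau> + \<beta>P * (s b)\<^sup>2) * (s b * (t \<bullet> b))\<^sup>2"
  have "0 \<le> ?q b" if b: "b \<in> B" for b
  proof (cases "s b = 0")
    case True
    \<comment> \<open>Here \<open>b\<close> is in the kernel of \<open>L\<close>, and
      \<open>a\<close>, being in the range of the transpose, is orthogonal to it: every term
      vanishes.\<close>
    have "a \<bullet> b = u \<bullet> (L *v b)"
      unfolding u by (subst inner_commute) (simp add: inner_matrix_transpose[symmetric] inner_commute)
    moreover have "(norm (L *v b))\<^sup>2 = 0"
      using singular_value_norm[OF B(3)[OF b]] True by simp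
    ultimately show ?thesis using True by simp
  next
    case False
    then have \<sigma>: "s b \<in> pos_singular_values L" using B(2)[OF b] by simp
    show ?thesis
      using eta_le[OF L pos le \<sigma>, of \<beta>P \<beta>D] pos_singular_value_le_opnorm(1)[OF \<sigma>]
      by (intro singular_pair_form_nonneg pos) (auto simp: \<eta>_def)
  qed
  then have "0 \<le> (\<Sum>b\<in>B. ?q b)" by (rule sum_nonneg)
  also have "\<dots> = (\<Sum>b\<in>B. (\<beta>P / \<gamma>\<^sup>2 - \<eta> / \<gamma>) * (a \<bullet> b)\<^sup>2 + \<beta>D * ((s b)\<^sup>2 * (a \<bullet> b)\<^sup>2)
      - 2 * (\<beta>P / \<gamma> + \<beta>D / \<tau> - \<eta>) * ((s b)\<^sup>2 * (a \<bullet> b) * (t \<bullet> b))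
      + (\<beta>D / \<tau>\<^sup>2 - \<eta> / \<tau>) * ((s b)\<^sup>2 * (t \<bullet> b)\<^sup>2) + \<beta>P * ((s b)\<^sup>2 * (s b)\<^sup>2 * (t \<bullet> b)\<^sup>2))"
    by (rule sum.cong) (simp_all add: power2_eq_square algebra_simps)
  also have "\<dots> = (\<beta>P / \<gamma>\<^sup>2 - \<eta> / \<gamma>) * (a \<bullet> a) + \<beta>D * ((L *v a) \<bullet> (L *v a))
      - 2 * (\<beta>P / \<gamma> + \<beta>D / \<tau> - \<eta>) * ((L *v a) \<bullet> y)
      + (\<beta>D / \<tau>\<^sup>2 - \<eta> / \<tau>) * (y \<bullet> y) + \<beta>P * ((transpose L *v y) \<bullet> (transpose L *v y))"
    unfolding aa yy LaLa Lay LyLy by (simp only: sum.distrib sum_subtractf sum_distrib_left)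
  also have "\<dots> = \<beta>P * (norm ((1 / \<gamma>) *\<^sub>R a - transpose L *v y))\<^sup>2
      + \<beta>D * (norm ((1 / \<tau>) *\<^sub>R y - L *v a))\<^sup>2
      - \<eta> * ((a \<bullet> a) / \<gamma> + (y \<bullet> y) / \<tau> - 2 * ((L *v a) \<bullet> y))"
    unfolding n1 n2 by (simp add: algebra_simps)
  finally show ?thesis by simp
qed

subsection \<open>The Chambolle--Pock algorithm\<close>

lemma linear_P_mat: "linear (P_mat L \<gamma> \<tau>)"
  by (rule linearI)
    (auto simp: P_mat_def matrix_vector_right_distrib matrix_vector_mult_scaleR algebra_simps)

lemma P_mat_sym: "P_mat L \<gamma> \<tau> u \<bullet> w = u \<bullet> P_mat L \<gamma> \<tau> w"
  by (cases u; cases w)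
    (simp add: P_mat_def inner_diff inner_add inner_matrix_transpose[symmetric] inner_commute
      flip: inner_matrix_transpose)

lemma inner_P_mat:
  "(x, y) \<bullet> P_mat L \<gamma> \<tau> (x, y) = (x \<bullet> x) / \<gamma> + (y \<bullet> y) / \<tau> - 2 * ((L *v x) \<bullet> y)"
  by (simp add: P_mat_def inner_diff inner_add inner_commute[of y "L *v x"] flip: inner_matrix_transpose)

lemma P_mat_psd:
  fixes L :: "real^'n^'m"
  assumes pos: "\<gamma> > 0" "\<tau> > 0" and le: "\<gamma> * \<tau> * (opnorm L)\<^sup>2 \<le> 1"
  shows "0 \<le> u \<bullet> P_mat L \<gamma> \<tau> u"
proof -
  obtain x y where u: "u = (x, y)" by (cases u)
  let ?g = "opnorm L"
  have "(L *v x) \<bullet> y \<le> norm (L *v x) * norm y" by (rule norm_cauchy_schwarz)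
  also have "\<dots> \<le> ?g * norm x * norm y"
    by (intro mult_right_mono onorm[OF matrix_vector_mul_bounded_linear]) simp
  finally have Lxy: "(L *v x) \<bullet> y \<le> ?g * norm x * norm y" .
  have "?g\<^sup>2 \<le> 1 / \<gamma> * (1 / \<tau>)" using le pos by (simp add: field_simps)
  then have "0 \<le> 1 / \<gamma> * (norm x)\<^sup>2 - 2 * ?g * norm x * norm y + 1 / \<tau> * (norm y)\<^sup>2"
    using pos by (intro quadratic_form_nonneg) auto
  then show ?thesis
    using Lxy unfolding u inner_P_mat power2_norm_eq_inner by simp
qed

lemma linear_V_mat: "linear (V_mat L \<beta>P \<beta>P' \<beta>D \<beta>D')"
proof -
  note lin = linear_orth_proj[OF subspace_rng] linear_orth_proj[OF subspace_ker]
  show ?thesis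
    by (rule linearI) (auto simp: V_mat_def linear_add[OF lin(1)] linear_add[OF lin(2)]
        linear_scale[OF lin(1)] linear_scale[OF lin(2)] algebra_simps)
qed

lemma inner_V_mat:
  fixes L :: "real^'n^'m"
  assumes "a \<in> rng (transpose L)" "b \<in> ker L" "c \<in> rng L" "d \<in> ker (transpose L)"
  shows "(a + b, c + d) \<bullet> V_mat L \<beta>P \<beta>P' \<beta>D \<beta>D' (a + b, c + d) =
    \<beta>P * (norm a)\<^sup>2 + \<beta>P' * (norm b)\<^sup>2 + \<beta>D * (norm c)\<^sup>2 + \<beta>D' * (norm d)\<^sup>2"
proof -
  have c: "c \<in> rng (transpose (transpose L))" using assms(3) by simp
  have "a \<bullet> b = 0" by (rule rng_orthogonal_ker[OF assms(1,2)])
  moreover have "c \<bullet> d = 0" by (rule rng_orthogonal_ker[OF c assms(4)])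
  ultimately show ?thesis
    using orth_proj_rng_ker[OF assms(1,2)] orth_proj_rng_ker[OF c assms(4)]
    by (simp add: V_mat_def power2_norm_eq_inner inner_add inner_commute[of b a] inner_commute[of d c])
qed

lemma inner_V_mat_flip:
  "(p, - q) \<bullet> V_mat L \<beta>P \<beta>P' \<beta>D \<beta>D' (p, - q) = (p, q) \<bullet> V_mat L \<beta>P \<beta>P' \<beta>D \<beta>D' (p, q)"
  by (simp add: V_mat_def linear_neg[OF linear_orth_proj[OF subspace_rng]]
      linear_neg[OF linear_orth_proj[OF subspace_ker]] inner_add inner_diff)

text \<open>A kernel parameter bounds \<open>eta_bar\<close> only if its kernel is nontrivial: at
  full rank it counts as infinite, and the component that it would weigh is zero.\<close>

lemma eta_bar_le:
  fixes L :: "real^'n^'m"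
  assumes pos: "\<gamma> > 0" "\<tau> > 0"
  shows "eta_bar L \<beta>P \<beta>P' \<beta>D \<beta>D' \<gamma> \<tau> \<le> eta L \<beta>P \<beta>D \<gamma> \<tau>"
    and "rank L \<noteq> CARD('n) \<Longrightarrow> eta_bar L \<beta>P \<beta>P' \<beta>D \<beta>D' \<gamma> \<tau> \<le> \<beta>P' / \<gamma>"
    and "rank L \<noteq> CARD('m) \<Longrightarrow> eta_bar L \<beta>P \<beta>P' \<beta>D \<beta>D' \<gamma> \<tau> \<le> \<beta>D' / \<tau>"
proof -
  let ?\<eta> = "eta_bar L \<beta>P \<beta>P' \<beta>D \<beta>D' \<gamma> \<tau>"
  have le: "ereal ?\<eta> \<le> ereal (eta L \<beta>P \<beta>D \<gamma> \<tau>)"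
    "ereal ?\<eta> \<le> ereal (1 / \<gamma>) * ext_\<beta>P' L \<beta>P'" "ereal ?\<eta> \<le> ereal (1 / \<tau>) * ext_\<beta>D' L \<beta>D'"
    unfolding ereal_eta_bar[OF pos] eta'_def by (simp_all add: min.coboundedI2)
  show "?\<eta> \<le> eta L \<beta>P \<beta>D \<gamma> \<tau>" using le(1) by simp
  show "?\<eta> \<le> \<beta>P' / \<gamma>" if "rank L \<noteq> CARD('n)" using le(2) that by (simp add: ext_\<beta>P'_def)
  show "?\<eta> \<le> \<beta>D' / \<tau>" if "rank L \<noteq> CARD('m)" using le(3) that by (simp add: ext_\<beta>D'_def)
qed

text \<open>\<open>P\<close> maps range parts to range parts and scales the kernel parts by 1 /
  \<gamma> and 1 / \<tau>, and cross terms vanish by orthogonality. Both sides therefore split: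
  \<open>eta\<close> governs the range part, \<beta>P' / \<gamma> and \<beta>D' / \<tau> govern the
  kernel parts.\<close>

lemma P_V_P_ge:
  fixes L :: "real^'n^'m"
  assumes L: "L \<noteq> 0" and pos: "\<gamma> > 0" "\<tau> > 0" and le: "\<gamma> * \<tau> * (opnorm L)\<^sup>2 \<le> 1"
  shows "eta_bar L \<beta>P \<beta>P' \<beta>D \<beta>D' \<gamma> \<tau> * (u \<bullet> P_mat L \<gamma> \<tau> u) \<le>
    P_mat L \<gamma> \<tau> u \<bullet> V_mat L \<beta>P \<beta>P' \<beta>D \<beta>D' (P_mat L \<gamma> \<tau> u)"
proof -
  let ?\<eta> = "eta_bar L \<beta>P \<beta>P' \<beta>D \<beta>D' \<gamma> \<tau>" and ?P = "P_mat L \<gamma> \<tau>"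
  obtain x y where u: "u = (x, y)" by (cases u)
  obtain a b where ab: "a \<in> rng (transpose L)" "b \<in> ker L" "x = a + b"
    by (rule rng_ker_decomposition)
  obtain c d where "c \<in> rng (transpose (transpose L))" and d: "d \<in> ker (transpose L)" "y = c + d"
    by (rule rng_ker_decomposition)
  then have c: "c \<in> rng L" by simp
  have Lb: "L *v b = 0" and Ld: "transpose L *v d = 0" using ab(2) d(1) by (simp_all add: ker_def)
  let ?a = "(1 / \<gamma>) *\<^sub>R a - transpose L *v c" and ?c = "(1 / \<tau>) *\<^sub>R c - L *v a"
  have Pu: "?P u = (?a + (1 / \<gamma>) *\<^sub>R b, ?c + (1 / \<tau>) *\<^sub>R d)"
    by (simp add: u ab(3) d(2) P_mat_def matrix_vector_right_distrib Lb Ld algebra_simps)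
  have mem: "?a \<in> rng (transpose L)" "(1 / \<gamma>) *\<^sub>R b \<in> ker L" "?c \<in> rng L" "(1 / \<tau>) *\<^sub>R d \<in> ker (transpose L)"
    using ab c d by (auto intro!: subspace_diff subspace_scale subspace_rng subspace_ker)
      (auto simp: rng_def)
  have "a \<bullet> b = 0" by (rule rng_orthogonal_ker[OF ab(1,2)])
  moreover have "c \<bullet> d = 0" using rng_orthogonal_ker[of c "transpose L" d] c d by simp
  moreover have "(L *v a) \<bullet> d = 0" by (simp add: inner_matrix_transpose Ld)
  ultimately have uPu: "u \<bullet> ?P u = (a, c) \<bullet> ?P (a, c) + ((b \<bullet> b) / \<gamma> + (d \<bullet> d) / \<tau>)"
    unfolding u inner_P_mat
    by (simp add: ab(3) d(2) matrix_vector_right_distrib Lb inner_add inner_commute[of b a]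
        inner_commute[of d c] add_divide_distrib)
  have "?\<eta> * ((a, c) \<bullet> ?P (a, c)) \<le> eta L \<beta>P \<beta>D \<gamma> \<tau> * ((a, c) \<bullet> ?P (a, c))"
    using eta_bar_le(1)[OF pos] P_mat_psd[OF pos le] by (rule mult_right_mono)
  also have "\<dots> \<le> \<beta>P * (norm ?a)\<^sup>2 + \<beta>D * (norm ?c)\<^sup>2"
    unfolding inner_P_mat by (rule range_form_nonneg[OF L pos le ab(1) c])
  finally have 1: "?\<eta> * ((a, c) \<bullet> ?P (a, c)) \<le> \<beta>P * (norm ?a)\<^sup>2 + \<beta>D * (norm ?c)\<^sup>2" .
  have 2: "?\<eta> * ((b \<bullet> b) / \<gamma>) \<le> \<beta>P' * (norm ((1 / \<gamma>) *\<^sub>R b))\<^sup>2"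
  proof (cases "rank L = CARD('n)")
    case True
    then show ?thesis using ker_trivial[OF _ ab(2)] by simp
  next
    case False
    have "?\<eta> * ((b \<bullet> b) / \<gamma>) \<le> \<beta>P' / \<gamma> * ((b \<bullet> b) / \<gamma>)"
      using eta_bar_le(2)[OF pos False] pos by (intro mult_right_mono) auto
    then show ?thesis using pos by (simp add: dot_square_norm power_divide power2_eq_square)
  qed
  have 3: "?\<eta> * ((d \<bullet> d) / \<tau>) \<le> \<beta>D' * (norm ((1 / \<tau>) *\<^sub>R d))\<^sup>2"
  proof (cases "rank L = CARD('m)")
    case True
    then show ?thesis using ker_trivial[OF _ d(1)] by (simp add: rank_transpose)
  next
    case False
    have "?\<eta> * ((d \<bullet> d) / \<tau>) \<le> \<beta>D' / \<tau> * ((d \<bullet> d) / \<tau>)"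
      using eta_bar_le(3)[OF pos False] pos by (intro mult_right_mono) auto
    then show ?thesis using pos by (simp add: dot_square_norm power_divide power2_eq_square)
  qed
  show ?thesis
    unfolding uPu unfolding Pu inner_V_mat[OF mem]
    using 1 2 3 by (simp only: distrib_left)
qed

text \<open>Undoing the translations, (p, q) is a value at (x, y) exactly if p - L^T y is in A x and
  y is in B (q + L x). The graph is thus an intersection of preimages of closed sets under
  continuous maps.\<close>

lemma closed_gph_T_PD:
  fixes L :: "real^'n^'m"
  assumes "outer_semicontinuous A" "outer_semicontinuous B"
  shows "closed (gph (T_PD L A B))"
proof -
  let ?f = "\<lambda>((x, y), (p, q)). (x, p - transpose L *v y)"
    and ?g = "\<lambda>((x, y), (p, q)). (q + L *v x, y)"
  have "gph (T_PD L A B) = ?f -` gph A \<inter> ?g -` gph B"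
  proof (intro set_eqI iffI)
    fix w assume "w \<in> gph (T_PD L A B)"
    then show "w \<in> ?f -` gph A \<inter> ?g -` gph B"
      by (auto simp: gph_def T_PD_def inv_op_def)
  next
    fix w assume w: "w \<in> ?f -` gph A \<inter> ?g -` gph B"
    obtain x y p q where [simp]: "w = ((x, y), (p, q))" by (metis surj_pair)
    have "p - transpose L *v y \<in> A x" "q + L *v x \<in> inv_op B y"
      using w by (simp_all add: gph_def inv_op_def)
    then have "p \<in> (\<lambda>a. a + transpose L *v y) ` A x" "q \<in> (\<lambda>b. b - L *v x) ` inv_op B y"
      by (auto intro!: image_eqI[of p _ "p - transpose L *v y"] image_eqI[of q _ "q + L *v x"])
    then show "w \<in> gph (T_PD L A B)"
      by (simp add: gph_def T_PD_def)
  qed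
  moreover have c: "continuous_on UNIV ?f" "continuous_on UNIV ?g"
    unfolding case_prod_beta
    by (intro continuous_intros bounded_linear.continuous_on[OF matrix_vector_mul_bounded_linear])+
  ultimately show ?thesis
    using assms closed_Int[OF closed_vimage[OF _ c(1)] closed_vimage[OF _ c(2)]]
    by (simp add: outer_semicontinuous_def)
qed

lemma mem_resolvent_scale_op:
  assumes "x \<in> resolvent (scale_op c A) s"
  obtains a where "a \<in> A x" "s = x + c *\<^sub>R a"
  using assms by (auto simp: resolvent_def inv_op_def scale_op_def)

text \<open>Testing the Minty inequality at a point that differs from a solution in one block only
  shows that the resolvents are locally bounded, although \<open>A\<close> and \<open>B\<close> need not be monotone.\<close>

lemma Minty_displacement_bound:
  fixes P V :: "'a::euclidean_space \<Rightarrow> 'a"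
  assumes P: "linear P" and V: "linear V" and pos: "0 < 1 + \<eta>" "0 < \<kappa>"
  obtains R where "\<And>w e. norm e \<le> M \<Longrightarrow> w \<bullet> P w = \<kappa> * (norm w)\<^sup>2 \<Longrightarrow>
    \<eta> * (w \<bullet> P w) \<le> P w \<bullet> V (P w) \<Longrightarrow> (e - P w) \<bullet> V (e - P w) \<le> (e - P w) \<bullet> w \<Longrightarrow> norm w \<le> R"
proof -
  have bl: "bounded_linear P" "bounded_linear V"
    using P V by (simp_all add: linear_conv_bounded_linear)
  define K p where "K = onorm V" and "p = onorm P"
  have K: "0 \<le> K" and p: "0 \<le> p" unfolding K_def p_def by (rule onorm_pos_le[OF bl(2)] onorm_pos_le[OF bl(1)])+
  have nP: "norm (P u) \<le> p * norm u" for u unfolding p_def by (rule onorm[OF bl(1)])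
  have V_bd: "\<bar>u \<bullet> V u'\<bar> \<le> K * norm u * norm u'" for u u'
  proof -
    have "\<bar>u \<bullet> V u'\<bar> \<le> norm u * norm (V u')" by (rule Cauchy_Schwarz_ineq2)
    also have "\<dots> \<le> norm u * (K * norm u')"
      unfolding K_def by (rule mult_left_mono[OF onorm[OF bl(2)]]) simp
    finally show ?thesis by (simp add: algebra_simps)
  qed
  \<comment> \<open>The target is c |w|^2 \<le> a |w| + b, where \<open>c\<close> comes from 1 +
    \<eta> and the form of \<open>P\<close>, \<open>a\<close> from the terms linear in
    \<open>w\<close>, and \<open>b\<close> from \<open>e \<bullet> V e\<close>.\<close>
  define c where "c = (1 + \<eta>) * \<kappa>"
  have c: "0 < c" using pos by (simp add: c_def)
  define a b where "a = \<bar>M\<bar> * (1 + 2 * K * p)" and "b = K * \<bar>M\<bar>\<^sup>2"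
  have ab: "0 \<le> a" "0 \<le> b" using K p by (simp_all add: a_def b_def)
  show ?thesis
  proof (rule that[of "max 1 ((a + b) / c)"])
    fix w e
    assume e: "norm e \<le> M" and wPw: "w \<bullet> P w = \<kappa> * (norm w)\<^sup>2"
      and ob: "\<eta> * (w \<bullet> P w) \<le> P w \<bullet> V (P w)"
      and Mi: "(e - P w) \<bullet> V (e - P w) \<le> (e - P w) \<bullet> w"
    have e': "norm e \<le> \<bar>M\<bar>" using e by simp
    have ew: "e \<bullet> w \<le> \<bar>M\<bar> * norm w"
      using norm_cauchy_schwarz[of e w] mult_right_mono[OF e' norm_ge_zero[of w]] by linarith
    have eP: "norm e * norm (P w) \<le> \<bar>M\<bar> * (p * norm w)"
      using e' nP by (intro mult_mono) auto
    have eVP: "\<bar>e \<bullet> V (P w)\<bar> \<le> K * (\<bar>M\<bar> * (p * norm w))" "\<bar>P w \<bullet> V e\<bar> \<le> K * (\<bar>M\<bar> * (p * norm w))"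
      using V_bd[of e "P w"] V_bd[of "P w" e] mult_left_mono[OF eP K]
      by (simp_all add: algebra_simps)
    have eVe: "\<bar>e \<bullet> V e\<bar> \<le> b"
    proof -
      have "norm e * norm e \<le> \<bar>M\<bar> * \<bar>M\<bar>" using e' by (intro mult_mono) auto
      then show ?thesis
        using V_bd[of e e] mult_left_mono[OF _ K] by (fastforce simp: b_def power2_eq_square mult.assoc)
    qed
    have "(e - P w) \<bullet> V (e - P w) = e \<bullet> V e - e \<bullet> V (P w) - P w \<bullet> V e + P w \<bullet> V (P w)"
      by (simp add: linear_diff[OF V] inner_diff)
    moreover have "(e - P w) \<bullet> w = e \<bullet> w - w \<bullet> P w"
      by (simp add: inner_diff inner_commute)
    ultimately have "(1 + \<eta>) * (w \<bullet> P w) \<le> \<bar>M\<bar> * norm w + 2 * (K * (\<bar>M\<bar> * (p * norm w))) + b"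
      using Mi ob ew eVP eVe by (simp add: distrib_right abs_le_iff)
    then have *: "c * (norm w)\<^sup>2 \<le> a * norm w + b"
      unfolding wPw by (simp add: c_def a_def algebra_simps)
    show "norm w \<le> max 1 ((a + b) / c)"
    proof (cases "norm w \<le> 1")
      case False
      \<comment> \<open>Outside the unit ball this makes the estimate divisible by |w|; hence the
        maximum with 1 in the bound.\<close>
      then have "b \<le> b * norm w" using ab(2) by (simp add: mult_le_cancel_left1)
      with * have "c * norm w * norm w \<le> (a + b) * norm w"
        by (simp add: power2_eq_square algebra_simps)
      moreover have "0 < norm w" using False by linarith
      ultimately have "c * norm w \<le> a + b" by (simp only: mult_le_cancel_right)
      then show ?thesis using c by (simp add: field_simps le_max_iff_disj)
    qed simp
  qed
qed

section \<open>Inclusions and bounds for the iterates\<close>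

lemma T_PD_memI:
  assumes "a \<in> A x" "b \<in> inv_op B y" "p = a + transpose L *v y" "q = b - L *v x"
  shows "(p, q) \<in> T_PD L A B (x, y)"
  using assms by (auto simp: T_PD_def)

lemma zer_T_PD_iff:
  "(x, y) \<in> zer (T_PD L A B) \<longleftrightarrow> - (transpose L *v y) \<in> A x \<and> L *v x \<in> inv_op B y"
  by (force simp: zer_def T_PD_def zero_prod_def eq_neg_iff_add_eq_0[symmetric])

text \<open>The dual resolvent gives (y - yb) / \<tau> = b - L (2 xb - x), and the off-diagonal
  block of \<open>P\<close> subtracts L (x - xb), leaving b - L xb. This cancellation is the purpose
  of the extrapolation.\<close>

lemma CPA_inclusion:
  assumes "CPA L A B \<gamma> \<tau> lam x y xb yb" and pos: "\<gamma> > 0" "\<tau> > 0"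
  shows "P_mat L \<gamma> \<tau> ((x k, y k) - (xb k, yb k)) \<in> T_PD L A B (xb k, yb k)"
proof -
  obtain a where a: "a \<in> A (xb k)" "x k - \<gamma> *\<^sub>R (transpose L *v y k) = xb k + \<gamma> *\<^sub>R a"
    using assms(1) unfolding CPA_def by (metis mem_resolvent_scale_op)
  obtain b where b: "b \<in> inv_op B (yb k)"
      "y k + \<tau> *\<^sub>R (L *v (2 *\<^sub>R xb k - x k)) = yb k + \<tau> *\<^sub>R b"
    using assms(1) unfolding CPA_def by (metis mem_resolvent_scale_op)
  have "x k - xb k = \<gamma> *\<^sub>R (a + transpose L *v y k)"
    using a(2) by (simp add: algebra_simps)
  then have 1: "(1 / \<gamma>) *\<^sub>R (x k - xb k) = a + transpose L *v y k" using pos by simp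
  have "y k - yb k = \<tau> *\<^sub>R (b - L *v (2 *\<^sub>R xb k - x k))"
    using b(2) by (simp add: algebra_simps)
  then have 2: "(1 / \<tau>) *\<^sub>R (y k - yb k) = b - L *v (2 *\<^sub>R xb k - x k)" using pos by simp
  have "L *v (2 *\<^sub>R xb k - x k) = L *v xb k + L *v xb k - L *v x k"
    by (simp only: matrix_vector_mult_diff_distrib scaleR_2 matrix_vector_right_distrib)
  note 2 = 2[unfolded this]
  show ?thesis
    unfolding P_mat_def diff_Pair prod.case 1 2
    by (rule T_PD_memI[where A = A and B = B, OF a(1) b(1)])
      (simp_all add: matrix_vector_mult_diff_distrib)
qed

text \<open>The test points are (xb, ys) and then (xs, yb). Their displacement from the solution
  lives in one block, where the form of \<open>P\<close> is a multiple of the squared norm even if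
  \<open>P\<close> is singular. The primal bound comes first because the input of the dual resolvent
  contains \<open>xb\<close>.\<close>

lemma CPA_bounded:
  fixes L :: "real^'n^'m"
  assumes L: "L \<noteq> 0" and pos: "\<gamma> > 0" "\<tau> > 0" and le: "\<gamma> * \<tau> * (opnorm L)\<^sup>2 \<le> 1"
    and Minty: "oblique_weak_Minty (V_mat L \<beta>P \<beta>P' \<beta>D \<beta>D') (T_PD L A B) S"
    and \<eta>: "0 < 1 + eta_bar L \<beta>P \<beta>P' \<beta>D \<beta>D' \<gamma> \<tau>"
    and cpa: "CPA L A B \<gamma> \<tau> lam x y xb yb"
    and bdd: "bounded (range (\<lambda>k. P_mat L \<gamma> \<tau> (x k, y k)))"
  shows "bounded (range (\<lambda>k. (xb k, yb k)))"
proof -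
  let ?P = "P_mat L \<gamma> \<tau>" and ?V = "V_mat L \<beta>P \<beta>P' \<beta>D \<beta>D'"
  note key = P_V_P_ge[OF L pos le, of \<beta>P \<beta>P' \<beta>D \<beta>D']
  obtain xs ys where S: "(xs, ys) \<in> S" using Minty by (auto simp: oblique_weak_Minty_def)
  then have "(xs, ys) \<in> zer (T_PD L A B)" using Minty by (auto simp: oblique_weak_Minty_def)
  then have zs: "- (transpose L *v ys) \<in> A xs" "L *v xs \<in> inv_op B ys"
    by (simp_all add: zer_T_PD_iff)
  have Mi: "w \<bullet> ?V w \<le> w \<bullet> (u - (xs, ys))" if "w \<in> T_PD L A B u" for u w
    using Minty S that unfolding oblique_weak_Minty_def gph_def by blast
  obtain M where M: "\<And>k. norm (?P (x k, y k)) \<le> M" using bdd by (auto simp: bounded_iff)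
  obtain M1 where M1: "\<And>k. norm (?P (x k, y k)) + norm (?P (xs, ys)) \<le> M1"
    using M by (metis add_le_cancel_right)
  \<comment> \<open>In the first-block test the residual is \<open>e - ?Q w\<close> instead of \<open>e - ?P w\<close>; as \<open>V\<close> is block
    diagonal, the sign of the second block does not matter.\<close>
  let ?Q = "P_mat (- L) \<gamma> \<tau>"
  note disp = Minty_displacement_bound[OF linear_P_mat linear_V_mat \<eta>]
  have pos': "0 < 1 / \<gamma>" "0 < 1 / \<tau>" using pos by simp_all
  obtain R1 where R1: "\<And>w e. norm e \<le> M1 \<Longrightarrow> w \<bullet> ?Q w = 1 / \<gamma> * (norm w)\<^sup>2 \<Longrightarrow>
      eta_bar L \<beta>P \<beta>P' \<beta>D \<beta>D' \<gamma> \<tau> * (w \<bullet> ?Q w) \<le> ?Q w \<bullet> ?V (?Q w) \<Longrightarrow>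
      (e - ?Q w) \<bullet> ?V (e - ?Q w) \<le> (e - ?Q w) \<bullet> w \<Longrightarrow> norm w \<le> R1"
    by (rule disp[OF pos'(1)]) (rule that)
  have neg_mat: "- L *v u = - (L *v u)" for u
    using matrix_vector_mult_diff_rdistrib[of 0 L u] by simp
  have x_bd: "norm (xb k - xs) \<le> R1" for k
  proof -
    obtain a where a: "a \<in> A (xb k)" "x k - \<gamma> *\<^sub>R (transpose L *v y k) = xb k + \<gamma> *\<^sub>R a"
      using cpa unfolding CPA_def by (metis mem_resolvent_scale_op)
    \<comment> \<open>Arranged so that \<open>e - ?Q w\<close> is the element of \<open>T_PD\<close>
      at (xb k, ys) built from \<open>a\<close> and the second inclusion of the zero (xs,
      ys).\<close>
    define e where "e = (fst (?P (x k, y k) - ?P (xs, ys)), 0 :: real^'m)"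
    define w where "w = (xb k - xs, 0 :: real^'m)"
    have "norm e \<le> norm (?P (x k, y k) - ?P (xs, ys))"
      using norm_fst_le[of "fst (?P (x k, y k) - ?P (xs, ys))" "snd (?P (x k, y k) - ?P (xs, ys))"]
      unfolding e_def norm_Pair prod.collapse by simp
    then have "norm e \<le> M1"
      using norm_triangle_ineq4[of "?P (x k, y k)" "?P (xs, ys)"] M1[of k] by linarith
    moreover have "w \<bullet> ?Q w = 1 / \<gamma> * (norm w)\<^sup>2"
      by (simp add: w_def inner_P_mat norm_Pair dot_square_norm)
    moreover have "eta_bar L \<beta>P \<beta>P' \<beta>D \<beta>D' \<gamma> \<tau> * (w \<bullet> ?Q w) \<le> ?Q w \<bullet> ?V (?Q w)"
    proof -
      have "?P w = ((1 / \<gamma>) *\<^sub>R (xb k - xs), - (L *v (xb k - xs)))"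
        "?Q w = ((1 / \<gamma>) *\<^sub>R (xb k - xs), - (- (L *v (xb k - xs))))"
        by (simp_all add: w_def P_mat_def neg_mat)
      then have "?Q w \<bullet> ?V (?Q w) = ?P w \<bullet> ?V (?P w)" by (simp only: inner_V_mat_flip)
      moreover have "w \<bullet> ?Q w = w \<bullet> ?P w" by (simp add: w_def inner_P_mat)
      ultimately show ?thesis using key[of w] by simp
    qed
    moreover have "(e - ?Q w) \<bullet> ?V (e - ?Q w) \<le> (e - ?Q w) \<bullet> w"
    proof -
      have "(1 / \<gamma>) *\<^sub>R (x k - \<gamma> *\<^sub>R (transpose L *v y k)) = (1 / \<gamma>) *\<^sub>R xb k + a"
        unfolding a(2) using pos by (simp add: scaleR_add_right)
      then have "e - ?Q w = (a + transpose L *v ys, L *v xs - L *v xb k)"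
        unfolding e_def w_def P_mat_def using pos
        by (auto simp: neg_mat matrix_vector_mult_diff_distrib algebra_simps)
      then have "e - ?Q w \<in> T_PD L A B (xb k, ys)"
        using T_PD_memI[where A = A and B = B, OF a(1) zs(2)] by simp
      from Mi[OF this] show ?thesis by (simp add: w_def)
    qed
    ultimately have "norm w \<le> R1" by (rule R1)
    then show ?thesis by (simp add: w_def norm_Pair)
  qed
  have Lx_bd: "norm (L *v xb k) \<le> opnorm L * (R1 + norm xs)" for k
  proof -
    have "norm (xb k) \<le> R1 + norm xs"
      using x_bd[of k] norm_triangle_ineq[of "xb k - xs" xs] by simp
    then have "opnorm L * norm (xb k) \<le> opnorm L * (R1 + norm xs)"
      using opnorm_pos[OF L] by (intro mult_left_mono) auto
    then show ?thesis using onorm[OF matrix_vector_mul_bounded_linear, of L "xb k"] by linarith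
  qed
  define M2 where "M2 = M + 2 * (opnorm L * (R1 + norm xs)) + norm (L *v xs) + norm ((1 / \<tau>) *\<^sub>R ys)"
  obtain R2 where R2: "\<And>w e. norm e \<le> M2 \<Longrightarrow> w \<bullet> ?P w = 1 / \<tau> * (norm w)\<^sup>2 \<Longrightarrow>
      (e - ?P w) \<bullet> ?V (e - ?P w) \<le> (e - ?P w) \<bullet> w \<Longrightarrow> norm w \<le> R2"
    by (rule disp[OF pos'(2)]) (rule that, use key in blast)
  have y_bd: "norm (yb k - ys) \<le> R2" for k
  proof -
    obtain b where b: "b \<in> inv_op B (yb k)"
        "y k + \<tau> *\<^sub>R (L *v (2 *\<^sub>R xb k - x k)) = yb k + \<tau> *\<^sub>R b"
      using cpa unfolding CPA_def by (metis mem_resolvent_scale_op)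
    \<comment> \<open>The mirror image: \<open>e - ?P w\<close> is the element at (xs, yb k) built
      from \<open>b\<close> and the first inclusion of the zero. \<open>M2\<close> bounds this
      \<open>e\<close> summand by summand.\<close>
    define e where
      "e = (0 :: real^'n, snd (?P (x k, y k)) + 2 *\<^sub>R (L *v xb k) - L *v xs - (1 / \<tau>) *\<^sub>R ys)"
    define w where "w = (0 :: real^'n, yb k - ys)"
    have "norm (snd (?P (x k, y k))) \<le> M" using M[of k] by (metis norm_snd_le order_trans prod.collapse)
    moreover have "norm (2 *\<^sub>R (L *v xb k)) \<le> 2 * (opnorm L * (R1 + norm xs))" using Lx_bd[of k] by simp
    ultimately have "norm (snd (?P (x k, y k)) + 2 *\<^sub>R (L *v xb k) - L *v xs - (1 / \<tau>) *\<^sub>R ys) \<le> M2"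
      unfolding M2_def by (intro norm_triangle_le_diff norm_triangle_le add_mono order_refl)
    then have "norm e \<le> M2" by (simp add: e_def norm_Pair)
    moreover have "w \<bullet> ?P w = 1 / \<tau> * (norm w)\<^sup>2"
      by (simp add: w_def inner_P_mat norm_Pair dot_square_norm)
    moreover have "(e - ?P w) \<bullet> ?V (e - ?P w) \<le> (e - ?P w) \<bullet> w"
    proof -
      have "(1 / \<tau>) *\<^sub>R (y k + \<tau> *\<^sub>R (L *v (2 *\<^sub>R xb k - x k))) = (1 / \<tau>) *\<^sub>R yb k + b"
        unfolding b(2) using pos by (simp add: scaleR_add_right)
      then have "(1 / \<tau>) *\<^sub>R y k = (1 / \<tau>) *\<^sub>R yb k + b - L *v (2 *\<^sub>R xb k - x k)"
        using pos by (simp add: scaleR_add_right algebra_simps)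
      then have "e - ?P w = (- (transpose L *v ys) + transpose L *v yb k, b - L *v xs)"
        unfolding e_def w_def P_mat_def
        by (simp add: matrix_vector_mult_diff_distrib matrix_vector_mult_scaleR algebra_simps)
      then have "e - ?P w \<in> T_PD L A B (xs, yb k)"
        using T_PD_memI[where A = A and B = B, OF zs(1) b(1)] by simp
      from Mi[OF this] show ?thesis by (simp add: w_def)
    qed
    ultimately have "norm w \<le> R2" by (rule R2)
    then show ?thesis by (simp add: w_def norm_Pair)
  qed
  have "norm ((xb k, yb k) - (xs, ys)) \<le> R1 + R2" for k
    using norm_Pair_le[of "xb k - xs" "yb k - ys"] x_bd[of k] y_bd[of k] by simp
  then have "norm (xb k, yb k) \<le> R1 + R2 + norm (xs, ys)" for k
    using norm_triangle_sub[of "(xb k, yb k)" "(xs, ys)"] by (smt (verit))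
  then show ?thesis by (auto simp: bounded_iff)
qed

text \<open>The resolvent inputs are continuous in \<open>P z\<close> and \<open>xb\<close>, so
  convergence of \<open>P z\<close> is enough, even where \<open>z\<close> itself does not
  converge.\<close>

lemma CPA_convergent:
  assumes cpa: "CPA L A B \<gamma> \<tau> lam x y xb yb" and pos: "\<gamma> > 0" "\<tau> > 0"
    and A: "single_valued_continuous (resolvent (scale_op \<gamma> A))"
    and B: "single_valued_continuous (resolvent (scale_op \<tau> (inv_op B)))"
    and lim: "(\<lambda>k. P_mat L \<gamma> \<tau> (x k, y k)) \<longlonglongrightarrow> w"
  shows "convergent (\<lambda>k. (xb k, yb k))"
proof -
  obtain f where f: "continuous_on UNIV f" "\<And>s. resolvent (scale_op \<gamma> A) s = {f s}"
    using A by (auto simp: single_valued_continuous_def)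
  obtain g where g: "continuous_on UNIV g" "\<And>s. resolvent (scale_op \<tau> (inv_op B)) s = {g s}"
    using B by (auto simp: single_valued_continuous_def)
  have c: "isCont f s" "isCont g t" for s t
    using f(1) g(1) by (simp_all add: continuous_on_eq_continuous_at)
  have xb_eq: "xb = (\<lambda>k. f (\<gamma> *\<^sub>R fst (P_mat L \<gamma> \<tau> (x k, y k))))"
    using cpa f(2) pos by (intro ext) (simp add: CPA_def P_mat_def scaleR_diff_right)
  have xb: "xb \<longlonglongrightarrow> f (\<gamma> *\<^sub>R fst w)"
    by (subst xb_eq) (intro isCont_tendsto_compose[OF c(1)] tendsto_intros lim)
  have "\<tau> *\<^sub>R (snd (P_mat L \<gamma> \<tau> (x k, y k)) + 2 *\<^sub>R (L *v xb k)) =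
      y k + \<tau> *\<^sub>R (L *v (2 *\<^sub>R xb k - x k))" for k
    using pos unfolding P_mat_def prod.case snd_conv matrix_vector_mult_diff_distrib
      matrix_vector_mult_scaleR by (simp add: scaleR_add_right scaleR_diff_right)
  then have yb_eq: "yb = (\<lambda>k. g (\<tau> *\<^sub>R (snd (P_mat L \<gamma> \<tau> (x k, y k)) + 2 *\<^sub>R (L *v xb k))))"
    using cpa g(2) by (intro ext) (simp add: CPA_def)
  have "yb \<longlonglongrightarrow> g (\<tau> *\<^sub>R (snd w + 2 *\<^sub>R (L *v f (\<gamma> *\<^sub>R fst w))))"
    by (subst yb_eq)
      (intro isCont_tendsto_compose[OF c(2)] tendsto_intros lim xb
        bounded_linear.tendsto[OF matrix_vector_mul_bounded_linear])
  then show ?thesis using tendsto_Pair[OF xb] by (auto simp: convergent_def)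
qed

theorem theorem3p4:
  fixes L :: "real^'n^'m"
    and A :: "real^'n \<Rightarrow> (real^'n) set"
    and B :: "real^'m \<Rightarrow> (real^'m) set"
    and \<gamma> \<tau> \<beta>P \<beta>P' \<beta>D \<beta>D' :: real
    and S :: "((real^'n) \<times> (real^'m)) set"
    and lam :: "nat \<Rightarrow> real"
    and x xb :: "nat \<Rightarrow> real^'n"
    and y yb :: "nat \<Rightarrow> real^'m"
    and z zb v :: "nat \<Rightarrow> (real^'n) \<times> (real^'m)"
    and T :: "(real^'n) \<times> (real^'m) \<Rightarrow> ((real^'n) \<times> (real^'m)) set"
    and proj :: "(real^'n) \<times> (real^'m) \<Rightarrow> (real^'n) \<times> (real^'m)"
  defines "T \<equiv> T_PD L A B"
    and "proj \<equiv> orth_proj (range (P_mat L \<gamma> \<tau>))"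
    and "z \<equiv> (\<lambda>k. (x k, y k))"
    and "zb \<equiv> (\<lambda>k. (xb k, yb k))"
    and "v \<equiv> (\<lambda>k. P_mat L \<gamma> \<tau> (z k - zb k))"
  assumes "L \<noteq> 0" and "\<gamma> > 0" and "\<tau> > 0"
    and A1: "outer_semicontinuous A" "outer_semicontinuous B"
    and A2: "dom_op (resolvent (scale_op \<gamma> A)) = UNIV"
            "dom_op (resolvent (scale_op \<tau> (inv_op B))) = UNIV"
    and A3: "zer T \<noteq> {}"
            "oblique_weak_Minty (V_mat L \<beta>P \<beta>P' \<beta>D \<beta>D') T S"
            "beta_conditions L \<beta>P \<beta>P' \<beta>D \<beta>D'"
    and stepsize: "stepsize_rule L \<beta>P \<beta>D \<gamma> \<tau>"
    and relaxation: "relaxation_rule L \<beta>P \<beta>P' \<beta>D \<beta>D' \<gamma> \<tau> lam"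
    and cpa: "CPA L A B \<gamma> \<tau> lam x y xb yb"
  shows "(\<exists>k. zb k \<in> zer T) \<or>
    (
      ((\<forall>k. v k \<in> T (zb k)) \<and> v \<longlonglongrightarrow> 0)
    \<and>
      (\<forall>l. seq_limit_point zb l \<longrightarrow> l \<in> zer T)
    \<and>
      (bounded (range (\<lambda>k. proj (z k))) \<and>
       bounded (range (\<lambda>k. proj (zb k))) \<and>
       (\<forall>l. seq_limit_point (\<lambda>k. proj (z k)) l \<longrightarrow> l \<in> proj ` zer T) \<and>
       (\<forall>l. seq_limit_point (\<lambda>k. proj (zb k)) l \<longrightarrow> l \<in> proj ` zer T))
    \<and>
      (proj ` S = proj ` zer T \<longrightarrow>
        (\<exists>l\<in>proj ` zer T. (\<lambda>k. proj (z k)) \<longlonglongrightarrow> l \<and> (\<lambda>k. proj (zb k)) \<longlonglongrightarrow> l) \<and>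
        (single_valued_continuous (resolvent (scale_op \<gamma> A)) \<and>
         single_valued_continuous (resolvent (scale_op \<tau> (inv_op B))) \<longrightarrow>
          (\<exists>zs\<in>zer T. zb \<longlonglongrightarrow> zs \<and>
            (uniformly_bounded_in lam 0 2 \<longrightarrow> z \<longlonglongrightarrow> zs))))
    )"
proof -
  let ?\<eta> = "eta_bar L \<beta>P \<beta>P' \<beta>D \<beta>D' \<gamma> \<tau>"
  have le: "\<gamma> * \<tau> * (opnorm L)\<^sup>2 \<le> 1"
    using stepsize \<open>L \<noteq> 0\<close> \<open>\<gamma> > 0\<close> by (rule stepsize_rule_le)
  have Minty_PD: "oblique_weak_Minty (V_mat L \<beta>P \<beta>P' \<beta>D \<beta>D') (T_PD L A B) S"
    using A3(2) unfolding T_def .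
  have lam: "0 < lam k" "lam k < 2 * (1 + ?\<eta>)" for k
    using relaxation by (auto simp: relaxation_rule_def Let_def)
  interpret oblique_pppa "P_mat L \<gamma> \<tau>" "V_mat L \<beta>P \<beta>P' \<beta>D \<beta>D'" T S ?\<eta> lam z zb
  proof (rule oblique_pppa.intro)
    show "linear (P_mat L \<gamma> \<tau>)" "linear (V_mat L \<beta>P \<beta>P' \<beta>D \<beta>D')"
      by (rule linear_P_mat linear_V_mat)+
    show "P_mat L \<gamma> \<tau> u \<bullet> w = u \<bullet> P_mat L \<gamma> \<tau> w" for u w by (rule P_mat_sym)
    show "0 \<le> u \<bullet> P_mat L \<gamma> \<tau> u" for u
      using \<open>\<gamma> > 0\<close> \<open>\<tau> > 0\<close> le by (rule P_mat_psd)
    show "closed (gph T)" unfolding T_def using A1 by (rule closed_gph_T_PD)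
    show "oblique_weak_Minty (V_mat L \<beta>P \<beta>P' \<beta>D \<beta>D') T S" by (rule A3(2))
    show "?\<eta> * (u \<bullet> P_mat L \<gamma> \<tau> u) \<le> P_mat L \<gamma> \<tau> u \<bullet> V_mat L \<beta>P \<beta>P' \<beta>D \<beta>D' (P_mat L \<gamma> \<tau> u)" for u
      using \<open>L \<noteq> 0\<close> \<open>\<gamma> > 0\<close> \<open>\<tau> > 0\<close> le by (rule P_V_P_ge)
    show "0 < lam k" "lam k < 2 * (1 + ?\<eta>)" for k by (rule lam)+
    show "0 < liminf (\<lambda>k. ereal (lam k * (2 * (1 + ?\<eta>) - lam k)))"
      using relaxation by (simp add: relaxation_rule_def Let_def)
    show "P_mat L \<gamma> \<tau> (z k - zb k) \<in> T (zb k)" for k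
      unfolding z_def zb_def T_def using cpa \<open>\<gamma> > 0\<close> \<open>\<tau> > 0\<close> by (rule CPA_inclusion)
    show "z (Suc k) = z k + lam k *\<^sub>R (zb k - z k)" for k
      using cpa by (simp add: z_def zb_def CPA_def)
  qed
  \<comment> \<open>The interval for \<open>lam 0\<close> is nonempty, which gives the strict bound
    on \<eta> behind the boundedness of \<open>zb\<close>.\<close>
  have "0 < 2 * (1 + ?\<eta>)" using lam[of 0] by (rule less_trans)
  then have \<eta>: "0 < 1 + ?\<eta>" by simp
  have bdd: "bounded (range zb)"
    using CPA_bounded[OF \<open>L \<noteq> 0\<close> \<open>\<gamma> > 0\<close> \<open>\<tau> > 0\<close> le Minty_PD \<eta> cpa] bounded_P_z
    by (simp only: zb_def z_def)
  have iv: "(\<exists>l\<in>proj ` zer T. (\<lambda>k. proj (z k)) \<longlonglongrightarrow> l \<and> (\<lambda>k. proj (zb k)) \<longlonglongrightarrow> l) \<and>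
      (single_valued_continuous (resolvent (scale_op \<gamma> A)) \<and>
       single_valued_continuous (resolvent (scale_op \<tau> (inv_op B))) \<longrightarrow>
        (\<exists>zs\<in>zer T. zb \<longlonglongrightarrow> zs \<and> (uniformly_bounded_in lam 0 2 \<longrightarrow> z \<longlonglongrightarrow> zs)))"
    if "proj ` S = proj ` zer T"
  proof -
    obtain zs where zs: "zs \<in> S" "(\<lambda>k. P_mat L \<gamma> \<tau> (z k - zs)) \<longlonglongrightarrow> 0"
      using P_z_convergent[OF bdd] \<open>proj ` S = proj ` zer T\<close> unfolding proj_def by blast
    have "(\<lambda>k. proj (z k)) \<longlonglongrightarrow> proj zs \<and> (\<lambda>k. proj (zb k)) \<longlonglongrightarrow> proj zs"
      unfolding proj_def using proj_tendsto[OF zs(2)] by blast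
    moreover have "zs \<in> zer T" using zs(1) S_subset by blast
    \<comment> \<open>The limit \<open>l\<close> may differ from \<open>zs\<close>, which is
      determined only up to the kernel of \<open>P\<close>; it is shown to be a zero separately, as
      a limit point of \<open>zb\<close>.\<close>
    moreover have "\<exists>l\<in>zer T. zb \<longlonglongrightarrow> l \<and> (uniformly_bounded_in lam 0 2 \<longrightarrow> z \<longlonglongrightarrow> l)"
      if J: "single_valued_continuous (resolvent (scale_op \<gamma> A))"
        "single_valued_continuous (resolvent (scale_op \<tau> (inv_op B)))"
    proof -
      have "(\<lambda>k. P_mat L \<gamma> \<tau> (x k, y k)) \<longlonglongrightarrow> P_mat L \<gamma> \<tau> zs"
        using zs(2) by (simp add: linear_diff[OF linear_P_mat] LIM_zero_iff z_def)
      from CPA_convergent[OF cpa \<open>\<gamma> > 0\<close> \<open>\<tau> > 0\<close> J this]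
      obtain l where l: "zb \<longlonglongrightarrow> l" by (auto simp: convergent_def zb_def)
      then have "seq_limit_point zb l"
        unfolding seq_limit_point_def by (intro exI[of _ id]) (simp add: strict_mono_id)
      then have "l \<in> zer T" by (rule limit_point_zer)
      then show ?thesis using l z_tendsto[OF l] by blast
    qed
    ultimately show ?thesis by blast
  qed
  show ?thesis
    using incl residual_tendsto_0 limit_point_zer bounded_proj_z bounded_proj_zb
      limit_point_proj_z[OF bdd] limit_point_proj_zb[OF bdd] iv
    unfolding v_def proj_def by blast
qed

end
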